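(* There exist constants $C,c>0$ such that, for all integers $n\ge 2$, if $d=(d_{ij})$ is a uniformly sampled metric space from $\mathcal{M}_n$, then $$\mathbb{P}\Big(\min_{i,j} d_{ij}\le 1-n^{-c}\Big)\le Cn^{-c},$$ where the minimum is over all pairs $\{i,j\}$ of distinct elements of $\{1,\dots,n\}$.
   Context: For an integer $n\ge 2$ write $[n]=\{1,\dots,n\}$ and let $\binom{[n]}{2}$ be the set of unordered pairs of distinct elements of $[n]$. The metric polytope $\mathcal{M}_n\subseteq\mathbb{R}^{\binom{n}{2}}$ is the set of all arrays $(d_{ij})$ indexed by $\{i,j\}\in\binom{[n]}{2}$ (with $d_{ij}=d_{ji}$) such that $0<d_{ij}\le 2$ for all $\{i,j\}$ and $d_{ij}\le d_{ik}+d_{kj}$ for all distinct $i,j,k\in[n]$. "Uniformly sampled" means sampled according to normalized Lebesgue measure on $\mathcal{M}_n$. *)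

theory Defs
  imports "HOL-Probability.Probability"
begin

definition pairs :: "nat \<Rightarrow> nat set set" where
  "pairs n = {e. e \<subseteq> {1..n} \<and> card e = 2}"

text \<open>An array indexed by unordered pairs is an extensional function on \<^term>\<open>pairs n\<close>
  (value \<^term>\<open>undefined\<close> off \<^term>\<open>pairs n\<close>), so the entry with indices \<open>i\<close>, \<open>j\<close> is
  \<^term>\<open>d {i, j}\<close>, and its symmetry is built in.\<close>

definition metric_polytope :: "nat \<Rightarrow> (nat set \<Rightarrow> real) set" where
  "metric_polytope n =
    {d \<in> extensional (pairs n).
       (\<forall>e\<in>pairs n. 0 < d e \<and> d e \<le> 2) \<and>
       (\<forall>i\<in>{1..n}. \<forall>j\<in>{1..n}. \<forall>k\<in>{1..n}.
          i \<noteq> j \<longrightarrow> i \<noteq> k \<longrightarrow> j \<noteq> k \<longrightarrow> d {i, j} \<le> d {i, k} + d {k, j})}"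

definition lebesgue_pairs :: "nat \<Rightarrow> (nat set \<Rightarrow> real) measure" where
  "lebesgue_pairs n = Pi\<^sub>M (pairs n) (\<lambda>_. lborel)"

definition uniform_metric :: "nat \<Rightarrow> (nat set \<Rightarrow> real) measure" where
  "uniform_metric n = uniform_measure (lebesgue_pairs n) (metric_polytope n)"

lemma finite_pairs [simp]: "finite (pairs n)"
  by (rule finite_subset[of _ "Pow {1..n}"]) (auto simp: pairs_def)

lemma pair_in_pairs: "i \<in> {1..n} \<Longrightarrow> j \<in> {1..n} \<Longrightarrow> i \<noteq> j \<Longrightarrow> {i, j} \<in> pairs n"
  by (auto simp: pairs_def)

lemma pairs_nonempty: "n \<ge> 2 \<Longrightarrow> pairs n \<noteq> {}"
  using pair_in_pairs[of 1 n 2] by auto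

lemma space_lebesgue_pairs: "space (lebesgue_pairs n) = extensional (pairs n)"
  by (simp add: lebesgue_pairs_def space_PiM PiE_def)

lemma measurable_entry:
  "e \<in> pairs n \<Longrightarrow> (\<lambda>d. d e) \<in> borel_measurable (lebesgue_pairs n)"
  unfolding lebesgue_pairs_def
  using measurable_component_singleton[of e "pairs n" "\<lambda>_. lborel"] by simp

lemma metric_polytope_sets [measurable]: "metric_polytope n \<in> sets (lebesgue_pairs n)"
proof -
  let ?M = "lebesgue_pairs n"
  have 1: "{d \<in> space ?M. \<forall>e\<in>pairs n. 0 < d e \<and> d e \<le> 2} \<in> sets ?M"
    by (intro sets.sets_Collect_finite_All sets.sets_Collect_conj borel_measurable_less
        borel_measurable_le measurable_entry borel_measurable_const finite_pairs)
  have 2: "{d \<in> space ?M. d {i, j} \<le> d {i, k} + d {k, j}} \<in> sets ?M"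
    if "i \<in> {1..n}" "j \<in> {1..n}" "k \<in> {1..n}" "i \<noteq> j" "i \<noteq> k" "j \<noteq> k" for i j k
    using that by (intro borel_measurable_le borel_measurable_add measurable_entry pair_in_pairs) auto
  have "{d \<in> space ?M. i \<noteq> j \<longrightarrow> i \<noteq> k \<longrightarrow> j \<noteq> k \<longrightarrow> d {i, j} \<le> d {i, k} + d {k, j}} \<in> sets ?M"
    if "i \<in> {1..n}" "j \<in> {1..n}" "k \<in> {1..n}" for i j k
    using 2[OF that] by (cases "i \<noteq> j \<and> i \<noteq> k \<and> j \<noteq> k") auto
  then have "{d \<in> space ?M. \<forall>i\<in>{1..n}. \<forall>j\<in>{1..n}. \<forall>k\<in>{1..n}.
      i \<noteq> j \<longrightarrow> i \<noteq> k \<longrightarrow> j \<noteq> k \<longrightarrow> d {i, j} \<le> d {i, k} + d {k, j}} \<in> sets ?M"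
    by (intro sets.sets_Collect_finite_All finite_atLeastAtMost)
  from sets.sets_Collect_conj[OF this 1] show ?thesis
    by (simp only: metric_polytope_def space_lebesgue_pairs)
qed

lemma emeasure_box:
  assumes "a \<le> b"
  shows "emeasure (lebesgue_pairs n) (Pi\<^sub>E (pairs n) (\<lambda>_. {a..b})) = ennreal (b - a) ^ card (pairs n)"
proof -
  interpret product_sigma_finite "\<lambda>_ :: nat set. lborel :: real measure"
    by standard
  show ?thesis
    using assms by (simp add: lebesgue_pairs_def emeasure_PiM)
qed

lemma emeasure_metric_polytope:
  "0 < emeasure (lebesgue_pairs n) (metric_polytope n)"
  "emeasure (lebesgue_pairs n) (metric_polytope n) < \<infinity>"
proof -
  have "Pi\<^sub>E (pairs n) (\<lambda>_. {1..2}) \<subseteq> metric_polytope n"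
  proof
    fix d :: "nat set \<Rightarrow> real" assume d: "d \<in> Pi\<^sub>E (pairs n) (\<lambda>_. {1..2})"
    then have *: "1 \<le> d e \<and> d e \<le> 2" if "e \<in> pairs n" for e
      using that by auto
    have "d {i, j} \<le> d {i, k} + d {k, j}"
      if "i \<in> {1..n}" "j \<in> {1..n}" "k \<in> {1..n}" "i \<noteq> j" "i \<noteq> k" "j \<noteq> k" for i j k
      using *[OF pair_in_pairs[of i n j]] *[OF pair_in_pairs[of i n k]] *[OF pair_in_pairs[of k n j]] that
      by force
    with * d show "d \<in> metric_polytope n"
      unfolding metric_polytope_def by (fastforce simp: PiE_def)
  qed
  from emeasure_mono[OF this metric_polytope_sets] emeasure_box[of 1 2 n]
  show "0 < emeasure (lebesgue_pairs n) (metric_polytope n)"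
    by (simp add: less_le_trans[OF zero_less_one])
  have "metric_polytope n \<subseteq> Pi\<^sub>E (pairs n) (\<lambda>_. {0..2})"
    by (auto simp: metric_polytope_def PiE_def less_imp_le)
  moreover have "Pi\<^sub>E (pairs n) (\<lambda>_. {0..2}) \<in> sets (lebesgue_pairs n)"
    by (auto simp: lebesgue_pairs_def intro!: sets_PiM_I_finite)
  ultimately have "emeasure (lebesgue_pairs n) (metric_polytope n) \<le> ennreal 2 ^ card (pairs n)"
    using emeasure_box[of 0 2 n] emeasure_mono by fastforce
  also have "\<dots> < \<infinity>"
    by (simp add: power_less_top_ennreal)
  finally show "emeasure (lebesgue_pairs n) (metric_polytope n) < \<infinity>" .
qed

lemma prob_space_uniform_metric: "prob_space (uniform_metric n)"
  unfolding uniform_metric_def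
  using emeasure_metric_polytope[of n] by (intro prob_space_uniform_measure) auto

lemma min_measurable:
  assumes "n \<ge> 2"
  shows "(\<lambda>d. Min (d ` pairs n)) \<in> borel_measurable (uniform_metric n)"
proof -
  have "(\<lambda>d. Min ((\<lambda>e. d e) ` pairs n)) \<in> borel_measurable (lebesgue_pairs n)"
    using measurable_entry[of _ n] by (intro borel_measurable_Min) auto
  then show ?thesis
    by (simp add: uniform_metric_def)
qed

end

theory Submission
  imports Defs "HOL-Real_Asymp.Real_Asymp"
begin

text \<open>The entropy estimate cannot finish alone: it bounds \<open>F (1 - 2 * \<eta>)\<close>
  only by a fixed small negative power of \<open>n\<close>, while the union bound runs over about
  \<open>n\<^sup>2\<close> pairs. Log-concavity is the amplifier; it asks only that this estimate
  lie a factor 2 below the crude bound \<open>\<gamma>\<^sup>2 / 8\<close> for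
  \<open>F (1 + 2 * \<gamma>)\<close>. Rounding replaces densities by Shannon entropy, which is
  never negative. A grid cell has volume \<open>1 / n ^ card (pairs n)\<close>, so a polytope of
  volume at least 1 forces entropy \<open>ln n\<close> per distance on average. Three independent
  sides cannot have more than about \<open>3 * ln n\<close>, so the two bounds meet, and the slack
  between them controls the mass to the left of 1. Near independence has to be extracted: nothing
  gives it directly. The entropy of one side starts at no more than \<open>ln (2 * n)\<close> and
  decreases as further vertices are conditioned on, so among \<open>M\<close> steps one drop is at
  most \<open>ln (2 * n) / M\<close>. A step bounds the dependence between sides because revealing
  all distances to vertex 3 reveals in particular the other two sides of the triangle 1, 2,
  3.\<close>

text \<open>Let \<open>F t\<close> be the probability that \<open>d {1, 2} \<le> t\<close>. By the Prekopa-Leindler inequality \<open>F\<close> is log-concave,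
  so if \<open>F\<close> at least doubles between \<open>1 - 2 \<gamma>\<close> and \<open>1 + 2 \<gamma>\<close>, it halves at every further step of length \<open>4 \<gamma>\<close>
  to the left. With \<open>\<gamma>\<close> a small negative power of \<open>n\<close> this makes \<open>F (1 - n powr (- c))\<close> smaller than every
  power of \<open>n\<close>, and a union bound over the pairs suffices.

  The doubling follows from an entropy argument for the metric \<open>\<lceil>n d\<rceil>\<close>. Since the polytope has volume at least 1,
  each distance has entropy at least \<open>ln n\<close>, also when conditioned on all distances to a few vertices; this
  already bounds \<open>F (1 + 2 \<gamma>)\<close> from below. Adding these vertices one at a time, the conditional entropy must at
  some step hardly drop, and then by exchangeability the three sides of a triangle are almost independent given
  the conditioning. Three independent variables in \<open>[0, 2]\<close> that always satisfy the triangle inequalities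
  range over intervals with lengths of mean at most 1, with equality only for \<open>[1, 2]\<close>, so the conditional
  entropies leave little mass to the left of 1.\<close>

section \<open>The Prekopa-Leindler inequality\<close>

text \<open>A cofinal increasing sequence inside \<open>A\<close> exhausts \<open>A\<close>. Cutting
  at points of \<open>A\<close> itself lets the proof of Brunn-Minkowski treat any Borel set
  directly, where the usual argument first passes to compact subsets.\<close>

lemma emeasure_SUP_atMost:
  fixes A :: "real set"
  assumes A: "A \<in> sets borel" "A \<noteq> {}"
  shows "(SUP a\<in>A. emeasure lborel (A \<inter> {..a})) = emeasure lborel A"
proof -
  obtain X :: "nat \<Rightarrow> real" where X: "incseq X" "\<And>n. X n \<in> A" "\<And>x. x \<in> A \<Longrightarrow> \<exists>n. x \<le> X n"
  proof (cases "\<exists>a\<in>A. \<forall>x\<in>A. x \<le> a")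
    case True
    then obtain a where "a \<in> A" "\<forall>x\<in>A. x \<le> a" by blast
    then show ?thesis by (intro that[of "\<lambda>_. a"]) auto
  next
    case False
    then have noMax: "\<exists>x\<in>A. a < x" if "a \<in> A" for a using that by (meson not_le)
    obtain f :: "nat \<Rightarrow> real" where f: "\<And>n. f n \<in> A" "\<And>x. x \<in> A \<Longrightarrow> \<exists>n. x \<le> f n"
    proof (cases "bdd_above A")
      case True
      have "\<exists>y\<in>A. Sup A - 1 / Suc n < y" for n
        using less_cSupE[of "Sup A - 1 / Suc n" A] A by auto
      then obtain f where f: "\<And>n. f n \<in> A" "\<And>n. Sup A - 1 / Suc n < f n" by metis
      show ?thesis
      proof (rule that[of f])
        fix x assume "x \<in> A"
        then obtain y where "y \<in> A" "x < y" using noMax by blast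
        then have "x < Sup A" using cSup_upper[OF _ True] by fastforce
        then obtain n where "1 / Suc n < Sup A - x"
          using reals_Archimedean[of "Sup A - x"] by (auto simp: inverse_eq_divide)
        with f(2)[of n] show "\<exists>n. x \<le> f n" by (intro exI[of _ n]) linarith
      qed (rule f)
    next
      case False
      then have "\<exists>y\<in>A. real n < y" for n by (auto simp: bdd_above_def not_le)
      then obtain f where f: "\<And>n. f n \<in> A" "\<And>n. real n < f n" by metis
      show ?thesis
        by (rule that[of f]) (use f in \<open>meson less_imp_le order_trans real_arch_simple\<close>)+
    qed
    \<comment> \<open>Running maxima make the cofinal sequence increasing without leaving
      \<open>A\<close>.\<close>
    define X where "X n = Max (f ` {..n})" for n
    have "X n \<in> A" for n
    proof -
      have "Max (f ` {..n}) \<in> f ` {..n}" by (intro Max_in) auto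
      then show ?thesis using f(1) unfolding X_def by (metis imageE)
    qed
    moreover have "incseq X"
      unfolding X_def incseq_def by (auto intro!: Max_mono)
    moreover have "f n \<le> X n" for n unfolding X_def by auto
    ultimately show ?thesis using that f(2) by (meson order_trans)
  qed
  have "emeasure lborel A = emeasure lborel (\<Union>n. A \<inter> {..X n})"
    using X(3) by (intro arg_cong[of _ _ "emeasure lborel"]) auto
  also have "\<dots> = (SUP n. emeasure lborel (A \<inter> {..X n}))"
    using A X(1) by (intro SUP_emeasure_incseq[symmetric]) (auto simp: incseq_def intro: order_trans)
  also have "\<dots> \<le> (SUP a\<in>A. emeasure lborel (A \<inter> {..a}))"
    using X(2) by (intro SUP_least SUP_upper2[of "X _"]) auto
  finally show ?thesis
    using A by (intro antisym SUP_least emeasure_mono) auto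
qed

lemma emeasure_lborel_vimage_affine:
  fixes A :: "real set"
  assumes A: "A \<in> sets borel" and c: "c \<noteq> 0"
  shows "emeasure lborel ((\<lambda>x. t + c * x) -` A) = emeasure lborel A / ennreal \<bar>c\<bar>"
proof -
  have "emeasure lborel A = \<bar>c\<bar> * (\<integral>\<^sup>+x. indicator A (t + c * x) \<partial>lborel)"
    using nn_integral_real_affine[of "indicator A" c t] A c by simp
  also have "(\<lambda>x. indicator A (t + c * x)) = (indicator ((\<lambda>x. t + c * x) -` A) :: real \<Rightarrow> ennreal)"
    by (auto simp: fun_eq_iff split: split_indicator)
  also have "integral\<^sup>N lborel \<dots> = emeasure lborel ((\<lambda>x. t + c * x) -` A)"
    using measurable_sets_borel[of "\<lambda>x. t + c * x" borel A] A by (intro nn_integral_indicator) auto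
  finally show ?thesis using c
    by (simp add: mult_divide_eq_ennreal mult.commute[of "ennreal \<bar>c\<bar>"])
qed

lemma emeasure_uminus_vimage:
  "A \<in> sets borel \<Longrightarrow> emeasure lborel (uminus -` A :: real set) = emeasure lborel A"
  using emeasure_lborel_vimage_affine[of A "-1" 0] by (simp add: divide_ennreal_def)

lemma emeasure_SUP_atLeast:
  fixes B :: "real set"
  assumes B: "B \<in> sets borel" "B \<noteq> {}"
  shows "(SUP b\<in>B. emeasure lborel (B \<inter> {b..})) = emeasure lborel B"
proof -
  let ?B = "uminus -` B :: real set"
  have "?B \<noteq> {}"
    by (metis B(2) ex_in_conv minus_minus vimageI2)
  moreover have m: "?B \<in> sets borel" using measurable_sets_borel[of uminus borel B] B by simp
  ultimately have "(SUP a\<in>?B. emeasure lborel (?B \<inter> {..a})) = emeasure lborel ?B"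
    by (intro emeasure_SUP_atMost)
  also have "?B = uminus ` B" by force
  finally have "(SUP b\<in>B. emeasure lborel (uminus ` B \<inter> {..- b})) = emeasure lborel (uminus -` B)"
    by (simp add: image_comp \<open>?B = uminus ` B\<close>)
  moreover have "emeasure lborel (uminus ` B \<inter> {..- b}) = emeasure lborel (B \<inter> {b..})" for b
  proof -
    have "uminus ` B \<inter> {..- b} = uminus -` (B \<inter> {b..})" by force
    then show ?thesis using B by (simp only: emeasure_uminus_vimage sets.Int borel_closed closed_atLeast)
  qed
  ultimately show ?thesis using B by (simp add: emeasure_uminus_vimage)
qed

text \<open>For \<open>a \<in> A\<close> and \<open>b \<in> B\<close> the sets \<open>A \<inter> {..a} + b\<close> and \<open>a + B \<inter> {b..}\<close> overlap only in \<open>a + b\<close>.\<close>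

lemma Brunn_Minkowski_real:
  fixes A B C :: "real set"
  assumes A: "A \<in> sets borel" "A \<noteq> {}" and B: "B \<in> sets borel" "B \<noteq> {}" and C: "C \<in> sets borel"
    and mid: "\<And>x y. x \<in> A \<Longrightarrow> y \<in> B \<Longrightarrow> (x + y) / 2 \<in> C"
  shows "emeasure lborel A + emeasure lborel B \<le> 2 * emeasure lborel C"
proof -
  have *: "emeasure lborel (A \<inter> {..a}) + emeasure lborel (B \<inter> {b..}) \<le> 2 * emeasure lborel C"
    if "a \<in> A" "b \<in> B" for a b
  proof -
    let ?A = "(\<lambda>x. - b + 1 * x) -` (A \<inter> {..a})" and ?B = "(\<lambda>x. - a + 1 * x) -` (B \<inter> {b..})"
    have m: "?A \<in> sets lborel" "?B \<in> sets lborel"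
      using A B measurable_sets_borel[of "\<lambda>x. - b + 1 * x" borel "A \<inter> {..a}"]
        measurable_sets_borel[of "\<lambda>x. - a + 1 * x" borel "B \<inter> {b..}"] by auto
    have "emeasure lborel (A \<inter> {..a}) + emeasure lborel (B \<inter> {b..}) = emeasure lborel ?A + emeasure lborel ?B"
      using A B by (subst (1 2) emeasure_lborel_vimage_affine) (auto simp: divide_ennreal_def)
    also have "\<dots> = emeasure lborel ?A + emeasure lborel (?B - {a + b})"
      using emeasure_Diff_null_set[OF finite_imp_null_set_lborel[of "{a + b}"] m(2)] by simp
    also have "\<dots> = emeasure lborel (?A \<union> (?B - {a + b}))"
      using m by (intro plus_emeasure) auto
    also have "\<dots> \<le> emeasure lborel ((\<lambda>x. 0 + 1/2 * x) -` C)"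
    proof (rule emeasure_mono)
      \<comment> \<open>Each point of either translate is a point of \<open>A\<close> plus a point
        of \<open>B\<close>, one summand being \<open>b\<close> or \<open>a\<close>; its half is
        therefore a midpoint.\<close>
      show "?A \<union> (?B - {a + b}) \<subseteq> (\<lambda>x. 0 + 1/2 * x) -` C"
        using mid[of "x - b" b for x] mid[of a "x - a" for x] that by fastforce
      show "(\<lambda>x. 0 + 1/2 * x) -` C \<in> sets lborel"
        using C measurable_sets_borel[of "\<lambda>x. 0 + 1/2 * x" borel C] by simp
    qed
    also have "\<dots> = 2 * emeasure lborel C"
    proof -
      have "inverse (ennreal \<bar>1 / 2\<bar>) = 2" by (subst abs_of_pos, simp, subst inverse_ennreal) auto
      then show ?thesis
        using emeasure_lborel_vimage_affine[OF C, of "1 / 2" 0] by (simp only: divide_ennreal_def mult.commute)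
    qed
    finally show ?thesis .
  qed
  have "emeasure lborel A + emeasure lborel B =
      (SUP a\<in>A. emeasure lborel (A \<inter> {..a})) + (SUP b\<in>B. emeasure lborel (B \<inter> {b..}))"
    using A B by (simp add: emeasure_SUP_atMost emeasure_SUP_atLeast)
  also have "\<dots> = (SUP a\<in>A. emeasure lborel (A \<inter> {..a}) + (SUP b\<in>B. emeasure lborel (B \<inter> {b..})))"
    by (rule ennreal_SUP_add_left[OF A(2), symmetric])
  also have "\<dots> = (SUP a\<in>A. SUP b\<in>B. emeasure lborel (A \<inter> {..a}) + emeasure lborel (B \<inter> {b..}))"
    by (subst ennreal_SUP_add_right[OF B(2)]) simp
  also have "\<dots> \<le> 2 * emeasure lborel C"
    using * by (intro SUP_least)
  finally show ?thesis .
qed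

text \<open>Levels are measured as a fraction \<open>t\<close> of \<open>\<alpha>\<close>, so that
  functions with different suprema can be compared at the same \<open>t\<close>. The truncation by
  \<open>inf\<close> covers functions that exceed \<open>\<alpha>\<close>, such as \<open>h\<close>
  below.\<close>

lemma layer_cake:
  fixes f :: "'a \<Rightarrow> ennreal" and \<alpha> :: real
  assumes [measurable]: "f \<in> borel_measurable M" and M: "sigma_finite_measure M" and \<alpha>: "\<alpha> > 0"
  shows "(\<integral>\<^sup>+x. inf (f x) (ennreal \<alpha>) \<partial>M) =
    ennreal \<alpha> * (\<integral>\<^sup>+t. emeasure M {x\<in>space M. ennreal (\<alpha> * t) < f x} * indicator {0..<1} t \<partial>lborel)"
proof -
  interpret M: sigma_finite_measure M by fact
  interpret pair_sigma_finite M lborel ..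
  have *: "inf v (ennreal \<alpha>) = ennreal \<alpha> * (\<integral>\<^sup>+t. indicator {t. 0 \<le> t \<and> t < 1 \<and> ennreal (\<alpha> * t) < v} t \<partial>lborel)" for v
  proof (cases v)
    case (real r)
    have "{t. 0 \<le> t \<and> t < 1 \<and> ennreal (\<alpha> * t) < v} = {0..<min 1 (r / \<alpha>)}"
      using \<alpha> real by (auto simp: ennreal_less_iff field_simps)
    then show ?thesis using \<alpha> real
      by (simp add: ennreal_mult[symmetric] inf_min min_def field_simps)
  next
    case top
    have "{t. 0 \<le> t \<and> t < 1 \<and> ennreal (\<alpha> * t) < v} = {0..<1}"
      using top by auto
    then show ?thesis using top by simp
  qed
  have "(\<integral>\<^sup>+x. inf (f x) (ennreal \<alpha>) \<partial>M) =
      (\<integral>\<^sup>+x. ennreal \<alpha> * (\<integral>\<^sup>+t. indicator {t. 0 \<le> t \<and> t < 1 \<and> ennreal (\<alpha> * t) < f x} t \<partial>lborel) \<partial>M)"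
    by (simp add: *)
  also have "\<dots> = ennreal \<alpha> * (\<integral>\<^sup>+x. (\<integral>\<^sup>+t. indicator {t. 0 \<le> t \<and> t < 1 \<and> ennreal (\<alpha> * t) < f x} t \<partial>lborel) \<partial>M)"
    by (intro nn_integral_cmult) measurable
  also have "(\<integral>\<^sup>+x. (\<integral>\<^sup>+t. indicator {t. 0 \<le> t \<and> t < 1 \<and> ennreal (\<alpha> * t) < f x} t \<partial>lborel) \<partial>M) =
     (\<integral>\<^sup>+t. (\<integral>\<^sup>+x. indicator {t. 0 \<le> t \<and> t < 1 \<and> ennreal (\<alpha> * t) < f x} t \<partial>M) \<partial>lborel)"
    by (intro Fubini'[symmetric]) measurable
  also have "\<dots> = (\<integral>\<^sup>+t. (\<integral>\<^sup>+x. indicator {x\<in>space M. ennreal (\<alpha> * t) < f x} x * indicator {0..<1} t \<partial>M) \<partial>lborel)"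
    by (intro nn_integral_cong) (auto split: split_indicator)
  also have "\<dots> = (\<integral>\<^sup>+t. emeasure M {x\<in>space M. ennreal (\<alpha> * t) < f x} * indicator {0..<1} t \<partial>lborel)"
    by (subst nn_integral_multc) auto
  finally show ?thesis .
qed

text \<open>Turns the additive inequality that Brunn-Minkowski gives for level sets into the product
  form of Prekopa-Leindler.\<close>

lemma ennreal_am_gm: "4 * (x * y) \<le> (x + y)\<^sup>2" for x y :: ennreal
proof (cases x; cases y)
  fix r s assume "0 \<le> r" "x = ennreal r" "0 \<le> s" "y = ennreal s"
  moreover have "4 * (r * s) \<le> (r + s)\<^sup>2" using sum_squares_bound[of r s] by (simp add: power2_sum)
  moreover have "(4::ennreal) = ennreal 4" by simp
  ultimately show ?thesis
    by (simp only: ennreal_plus[symmetric] ennreal_mult[symmetric] ennreal_power mult_nonneg_nonneg add_nonneg_nonneg zero_le_numeral) (simp add: ennreal_leI)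
qed (auto simp: power2_eq_square ennreal_mult_eq_top_iff top_add ennreal_top_mult)

lemma ennreal_mult_strict_mono: "a * b < c * d" if "a < c" "b < d" for a b c d :: ennreal
  using that
  by (cases a; cases b; cases c; cases d)
     (auto simp: ennreal_mult[symmetric] ennreal_less_iff ennreal_mult_top ennreal_top_mult
        simp del: ennreal_mult' intro!: mult_strict_mono)

text \<open>Put the levels at fraction \<open>t < 1\<close> of the suprema \<open>\<alpha>\<close>
  and \<open>\<beta>\<close>, so that both level sets are nonempty. With \<open>\<gamma>\<close> the
  geometric mean, the hypothesis sends midpoints of the level sets of \<open>f\<close> and
  \<open>g\<close> into the level set of \<open>h\<close> at \<open>\<gamma> * t\<close>.
  Brunn-Minkowski holds for each \<open>t\<close>; integrate over \<open>t\<close> and apply the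
  arithmetic-geometric mean inequality.\<close>

lemma Prekopa_Leindler_real_bounded:
  fixes f g h :: "real \<Rightarrow> ennreal"
  assumes [measurable]: "f \<in> borel_measurable borel" "g \<in> borel_measurable borel" "h \<in> borel_measurable borel"
    and fgh: "\<And>x y. f x * g y \<le> (h ((x + y) / 2))\<^sup>2"
    and bdd: "(SUP x. f x) < \<infinity>" "(SUP x. g x) < \<infinity>"
  shows "(\<integral>\<^sup>+x. f x \<partial>lborel) * (\<integral>\<^sup>+x. g x \<partial>lborel) \<le> (\<integral>\<^sup>+x. h x \<partial>lborel)\<^sup>2"
proof -
  obtain \<alpha> \<beta> where \<alpha>: "(SUP x. f x) = ennreal \<alpha>" "\<alpha> \<ge> 0" and \<beta>: "(SUP x. g x) = ennreal \<beta>" "\<beta> \<ge> 0"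
    using bdd by (metis ennreal_cases infinity_ennreal_def less_irrefl)
  have f_le: "f x \<le> ennreal \<alpha>" and g_le: "g x \<le> ennreal \<beta>" for x
    by (simp_all add: \<alpha>(1)[symmetric] \<beta>(1)[symmetric] SUP_upper)
  show ?thesis
  proof (cases "\<alpha> = 0 \<or> \<beta> = 0")
    case True
    then have "(\<forall>x. f x = 0) \<or> (\<forall>x. g x = 0)"
      using f_le g_le by (metis ennreal_0 le_zero_eq)
    then show ?thesis by auto
  next
    case False
    then have pos: "\<alpha> > 0" "\<beta> > 0" using \<alpha> \<beta> by auto
    define \<gamma> where "\<gamma> = sqrt (\<alpha> * \<beta>)"
    have \<gamma>: "\<gamma> > 0" "\<gamma> * \<gamma> = \<alpha> * \<beta>" using pos by (auto simp: \<gamma>_def)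
    define L where "L u c = (\<integral>\<^sup>+t. emeasure lborel {x. ennreal (c * t) < u x} * indicator {0..<1} t \<partial>lborel)"
      for u :: "real \<Rightarrow> ennreal" and c :: real
    have f_eq: "integral\<^sup>N lborel f = ennreal \<alpha> * L f \<alpha>" and g_eq: "integral\<^sup>N lborel g = ennreal \<beta> * L g \<beta>"
      using layer_cake[of f lborel \<alpha>] layer_cake[of g lborel \<beta>] pos f_le g_le
      by (simp_all add: L_def sigma_finite_lborel inf_absorb1)
    have h_ge: "ennreal \<gamma> * L h \<gamma> \<le> integral\<^sup>N lborel h"
      using layer_cake[of h lborel \<gamma>] \<gamma>(1) unfolding L_def
      by (simp add: sigma_finite_lborel) (metis (mono_tags, lifting) inf_le1 nn_integral_mono)
    have "emeasure lborel {x. ennreal (\<alpha> * t) < f x} + emeasure lborel {x. ennreal (\<beta> * t) < g x}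
        \<le> 2 * emeasure lborel {x. ennreal (\<gamma> * t) < h x}" if t: "0 \<le> t" "t < 1" for t
    proof (rule Brunn_Minkowski_real)
      have "ennreal (\<alpha> * t) < (SUP x. f x)" "ennreal (\<beta> * t) < (SUP x. g x)"
        unfolding \<alpha> \<beta> using t pos by (auto simp: ennreal_less_iff)
      then show "{x. ennreal (\<alpha> * t) < f x} \<noteq> {}" "{x. ennreal (\<beta> * t) < g x} \<noteq> {}"
        by (auto simp: less_SUP_iff)
      fix x y assume "x \<in> {x. ennreal (\<alpha> * t) < f x}" "y \<in> {x. ennreal (\<beta> * t) < g x}"
      then have "ennreal (\<alpha> * t) * ennreal (\<beta> * t) < f x * g y"
        by (intro ennreal_mult_strict_mono) auto
      also have "ennreal (\<alpha> * t) * ennreal (\<beta> * t) = (ennreal (\<gamma> * t))\<^sup>2"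
      proof -
        have "\<alpha> * t * (\<beta> * t) = \<gamma> * t * (\<gamma> * t)" using \<gamma>(2) by (simp add: algebra_simps)
        then show ?thesis using \<gamma> t pos by (simp add: power2_eq_square ennreal_mult[symmetric])
      qed
      also have "f x * g y \<le> (h ((x + y) / 2))\<^sup>2" by (rule fgh)
      finally show "(x + y) / 2 \<in> {x. ennreal (\<gamma> * t) < h x}"
        by (metis mem_Collect_eq not_le order_less_le_trans power_mono zero_le order_less_irrefl)
    qed measurable
    then have "L f \<alpha> + L g \<beta> \<le> 2 * L h \<gamma>"
      unfolding L_def
      by (subst nn_integral_add[symmetric], measurable)
         (subst nn_integral_cmult[symmetric], measurable, auto intro!: nn_integral_mono split: split_indicator)
    then have "(L f \<alpha> + L g \<beta>)\<^sup>2 \<le> (2 * L h \<gamma>)\<^sup>2" by (intro power_mono) auto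
    then have "4 * (L f \<alpha> * L g \<beta>) \<le> 4 * (L h \<gamma>)\<^sup>2"
      using ennreal_am_gm[of "L f \<alpha>" "L g \<beta>"] by (simp add: power_mult_distrib)
    then have "L f \<alpha> * L g \<beta> \<le> (L h \<gamma>)\<^sup>2"
      by (subst (asm) ennreal_mult_le_mult_iff) auto
    then have "(ennreal \<gamma>)\<^sup>2 * (L f \<alpha> * L g \<beta>) \<le> (ennreal \<gamma> * L h \<gamma>)\<^sup>2"
      by (simp add: power_mult_distrib mult_left_mono)
    also have "\<dots> \<le> (integral\<^sup>N lborel h)\<^sup>2" using h_ge by (intro power_mono) auto
    also have "(ennreal \<gamma>)\<^sup>2 * (L f \<alpha> * L g \<beta>) = integral\<^sup>N lborel f * integral\<^sup>N lborel g"
    proof -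
      have "(ennreal \<gamma>)\<^sup>2 = ennreal \<alpha> * ennreal \<beta>"
        using \<gamma> pos by (simp add: power2_eq_square ennreal_mult[symmetric])
      then show ?thesis by (simp add: f_eq g_eq mult_ac)
    qed
    finally show ?thesis .
  qed
qed

lemma nn_integral_SUP_truncate:
  assumes [measurable]: "f \<in> borel_measurable M"
  shows "(SUP k. \<integral>\<^sup>+x. inf (f x) (of_nat k) \<partial>M) = (\<integral>\<^sup>+x. f x \<partial>M)"
proof -
  have "(\<integral>\<^sup>+x. f x \<partial>M) = (\<integral>\<^sup>+x. (SUP k. inf (f x) (of_nat k)) \<partial>M)"
    by (intro nn_integral_cong) (simp add: inf_SUP[symmetric] ennreal_SUP_of_nat_eq_top)
  also have "\<dots> = (SUP k. \<integral>\<^sup>+x. inf (f x) (of_nat k) \<partial>M)"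
    by (intro nn_integral_monotone_convergence_SUP)
       (auto simp: incseq_def le_fun_def intro!: le_infI2)
  finally show ?thesis ..
qed

lemma Prekopa_Leindler_real:
  fixes f g h :: "real \<Rightarrow> ennreal"
  assumes [measurable]: "f \<in> borel_measurable borel" "g \<in> borel_measurable borel" "h \<in> borel_measurable borel"
    and fgh: "\<And>x y. f x * g y \<le> (h ((x + y) / 2))\<^sup>2"
  shows "(\<integral>\<^sup>+x. f x \<partial>lborel) * (\<integral>\<^sup>+x. g x \<partial>lborel) \<le> (\<integral>\<^sup>+x. h x \<partial>lborel)\<^sup>2"
proof -
  \<comment> \<open>Lowering only \<open>f\<close> and \<open>g\<close> preserves the hypothesis, so
    boundedness is removed by monotone convergence in \<open>k\<close> and \<open>l\<close>
    separately.\<close>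
  have *: "(\<integral>\<^sup>+x. inf (f x) (of_nat k) \<partial>lborel) * (\<integral>\<^sup>+x. inf (g x) (of_nat l) \<partial>lborel) \<le> (\<integral>\<^sup>+x. h x \<partial>lborel)\<^sup>2"
    for k l :: nat
  proof (rule Prekopa_Leindler_real_bounded)
    show "inf (f x) (of_nat k) * inf (g y) (of_nat l) \<le> (h ((x + y) / 2))\<^sup>2" for x y
      using fgh[of x y] by (meson inf_le1 mult_mono order_trans zero_le)
    have "(SUP x. inf (f x) (of_nat k)) \<le> of_nat k" "(SUP x. inf (g x) (of_nat l)) \<le> of_nat l"
      by (auto intro!: SUP_least)
    then show "(SUP x. inf (f x) (of_nat k)) < \<infinity>" "(SUP x. inf (g x) (of_nat l)) < \<infinity>"
      by (auto simp: le_less_trans[OF _ of_nat_less_top])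
  qed measurable
  have "(\<integral>\<^sup>+x. f x \<partial>lborel) * (\<integral>\<^sup>+x. g x \<partial>lborel) =
     (SUP k. SUP l. (\<integral>\<^sup>+x. inf (f x) (of_nat k) \<partial>lborel) * (\<integral>\<^sup>+x. inf (g x) (of_nat l) \<partial>lborel))"
    by (simp add: SUP_mult_left_ennreal[symmetric] SUP_mult_right_ennreal[symmetric] nn_integral_SUP_truncate)
  also have "\<dots> \<le> (\<integral>\<^sup>+x. h x \<partial>lborel)\<^sup>2" using * by (intro SUP_least)
  finally show ?thesis .
qed

text \<open>Tensorisation: with the values \<open>s\<close> and \<open>t\<close> of the new
  coordinate fixed, the induction hypothesis for the slices is exactly the one-dimensional
  hypothesis for the slice integrals \<open>S f\<close>, \<open>S g\<close>,
  \<open>S h\<close>.\<close>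

theorem Prekopa_Leindler_PiM:
  fixes f g h :: "('i \<Rightarrow> real) \<Rightarrow> ennreal"
  assumes "finite I"
    and "f \<in> borel_measurable (Pi\<^sub>M I (\<lambda>_. lborel))" "g \<in> borel_measurable (Pi\<^sub>M I (\<lambda>_. lborel))"
    "h \<in> borel_measurable (Pi\<^sub>M I (\<lambda>_. lborel))"
    and "\<And>x y. x \<in> extensional I \<Longrightarrow> y \<in> extensional I \<Longrightarrow> f x * g y \<le> (h (\<lambda>i\<in>I. (x i + y i) / 2))\<^sup>2"
  shows "integral\<^sup>N (Pi\<^sub>M I (\<lambda>_. lborel)) f * integral\<^sup>N (Pi\<^sub>M I (\<lambda>_. lborel)) g
    \<le> (integral\<^sup>N (Pi\<^sub>M I (\<lambda>_. lborel)) h)\<^sup>2"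
  using assms
proof (induction I arbitrary: f g h rule: finite_induct)
  case empty
  interpret product_sigma_finite "\<lambda>_ :: 'i. lborel :: real measure" by standard
  show ?case using empty(4)[of "\<lambda>_. undefined" "\<lambda>_. undefined"] empty(1-3)
    by (simp add: nn_integral_empty restrict_def)
next
  case (insert i I)
  interpret product_sigma_finite "\<lambda>_ :: 'i. lborel :: real measure" by standard
  note [measurable] = insert.prems(1-3)
  interpret I: sigma_finite_measure "Pi\<^sub>M I (\<lambda>_. lborel :: real measure)"
    by (rule sigma_finite) fact
  define S where "S u t = (\<integral>\<^sup>+x. u (x(i := t)) \<partial>Pi\<^sub>M I (\<lambda>_. lborel))" for u :: "('i \<Rightarrow> real) \<Rightarrow> ennreal" and t
  have meas: "S u \<in> borel_measurable borel"
    if [measurable]: "u \<in> borel_measurable (Pi\<^sub>M (insert i I) (\<lambda>_. lborel))" for u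
  proof -
    have "S u \<in> borel_measurable lborel"
      unfolding S_def by (intro I.borel_measurable_nn_integral) measurable
    then show ?thesis by simp
  qed
  have int: "integral\<^sup>N (Pi\<^sub>M (insert i I) (\<lambda>_. lborel)) u = integral\<^sup>N lborel (S u)"
    if [measurable]: "u \<in> borel_measurable (Pi\<^sub>M (insert i I) (\<lambda>_. lborel))" for u
    using product_nn_integral_insert_rev[OF insert(1,2) that] by (simp add: S_def[abs_def])
  have "S f s * S g t \<le> (S h ((s + t) / 2))\<^sup>2" for s t
    unfolding S_def
  proof (rule insert.IH)
    fix x y :: "'i \<Rightarrow> real" assume "x \<in> extensional I" "y \<in> extensional I"
    then have "f (x(i := s)) * g (y(i := t)) \<le> (h (\<lambda>j\<in>insert i I. ((x(i := s)) j + (y(i := t)) j) / 2))\<^sup>2"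
      by (intro insert.prems) (auto simp: extensional_def)
    also have "(\<lambda>j\<in>insert i I. ((x(i := s)) j + (y(i := t)) j) / 2) = (\<lambda>j\<in>I. (x j + y j) / 2)(i := (s + t) / 2)"
      using insert(2) by (auto simp: fun_eq_iff)
    finally show "f (x(i := s)) * g (y(i := t)) \<le> (h ((\<lambda>j\<in>I. (x j + y j) / 2)(i := (s + t) / 2)))\<^sup>2" .
  qed (use insert(1) in measurable)
  then have "integral\<^sup>N lborel (S f) * integral\<^sup>N lborel (S g) \<le> (integral\<^sup>N lborel (S h))\<^sup>2"
    by (intro Prekopa_Leindler_real meas insert.prems)
  then show ?case by (simp add: int insert.prems)
qed

section \<open>Entropy of finite distributions\<close>

text \<open>Shannon entropy in nats, written as a mean over outcomes instead of values. It depends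
  only on the partition of the support into fibres of \<open>f\<close>, so tuples and restrictions
  can be exchanged freely.\<close>

definition entropy_of :: "'w pmf \<Rightarrow> ('w \<Rightarrow> 'a) \<Rightarrow> real" where
  "entropy_of p f = (\<Sum>\<omega>\<in>set_pmf p. pmf p \<omega> * - ln (measure_pmf.prob p {\<omega>'. f \<omega>' = f \<omega>}))"

lemma prob_fibre_pos: "\<omega> \<in> set_pmf p \<Longrightarrow> measure_pmf.prob p {\<omega>'. f \<omega>' = f \<omega>} > 0"
  by (rule measure_pmf_posI) auto

lemma sum_pmf_fibre:
  assumes "finite (set_pmf p)"
  shows "(\<Sum>\<omega>\<in>{\<omega> \<in> set_pmf p. f \<omega> = x}. pmf p \<omega>) = measure_pmf.prob p {\<omega>. f \<omega> = x}"
proof -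
  have "measure_pmf.prob p {\<omega>. f \<omega> = x} = measure_pmf.prob p {\<omega> \<in> set_pmf p. f \<omega> = x}"
    by (rule measure_pmf.finite_measure_eq_AE) (auto simp: AE_measure_pmf_iff)
  then show ?thesis using assms by (simp add: measure_measure_pmf_finite)
qed

lemma sum_prob_fibres:
  "finite (set_pmf p) \<Longrightarrow> (\<Sum>x\<in>f ` set_pmf p. measure_pmf.prob p {\<omega>. f \<omega> = x}) = 1"
  by (simp add: sum_pmf_fibre[symmetric] sum.image_gen[symmetric] sum_pmf_eq_1)

lemma entropy_of_cong:
  assumes "\<And>\<omega> \<omega>'. \<omega> \<in> set_pmf p \<Longrightarrow> \<omega>' \<in> set_pmf p \<Longrightarrow> f \<omega> = f \<omega>' \<longleftrightarrow> g \<omega> = g \<omega>'"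
  shows "entropy_of p f = entropy_of p g"
  unfolding entropy_of_def
proof (rule sum.cong[OF refl])
  fix \<omega> assume "\<omega> \<in> set_pmf p"
  then have "measure_pmf.prob p {\<omega>'. f \<omega>' = f \<omega>} = measure_pmf.prob p {\<omega>'. g \<omega>' = g \<omega>}"
    using assms by (intro measure_pmf.finite_measure_eq_AE) (auto simp: AE_measure_pmf_iff)
  then show "pmf p \<omega> * - ln (measure_pmf.prob p {\<omega>'. f \<omega>' = f \<omega>}) =
      pmf p \<omega> * - ln (measure_pmf.prob p {\<omega>'. g \<omega>' = g \<omega>})" by simp
qed

lemma entropy_of_map: "inj_on \<sigma> (set_pmf p) \<Longrightarrow> entropy_of (map_pmf \<sigma> p) f = entropy_of p (f \<circ> \<sigma>)"
  by (simp add: entropy_of_def sum.reindex pmf_map_inj vimage_def)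

lemma entropy_of_nonneg: "entropy_of p f \<ge> 0"
  unfolding entropy_of_def
  by (intro sum_nonneg mult_nonneg_nonneg) (auto simp: measure_pmf.prob_le_1 prob_fibre_pos)

text \<open>The term \<open>(\<Sum>x. w x) - 1\<close> is kept because it is negative in the bound on the total correlation.\<close>

lemma Gibbs:
  assumes fin: "finite (set_pmf p)" and w: "\<And>\<omega>. \<omega> \<in> set_pmf p \<Longrightarrow> w (f \<omega>) > 0"
  shows "entropy_of p f \<le> (\<Sum>\<omega>\<in>set_pmf p. pmf p \<omega> * - ln (w (f \<omega>))) + (\<Sum>x\<in>f ` set_pmf p. w x) - 1"
proof -
  let ?P = "\<lambda>x. measure_pmf.prob p {\<omega>'. f \<omega>' = x}"
  have "entropy_of p f - (\<Sum>\<omega>\<in>set_pmf p. pmf p \<omega> * - ln (w (f \<omega>))) =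
      (\<Sum>\<omega>\<in>set_pmf p. pmf p \<omega> * (ln (w (f \<omega>)) - ln (?P (f \<omega>))))"
    unfolding entropy_of_def by (simp add: sum_subtractf[symmetric] sum_negf[symmetric] algebra_simps)
  also have "\<dots> \<le> (\<Sum>\<omega>\<in>set_pmf p. pmf p \<omega> * (w (f \<omega>) / ?P (f \<omega>) - 1))"
  proof (intro sum_mono mult_left_mono)
    fix \<omega> assume \<omega>: "\<omega> \<in> set_pmf p"
    then have "ln (w (f \<omega>)) - ln (?P (f \<omega>)) = ln (w (f \<omega>) / ?P (f \<omega>))"
      using w[OF \<omega>] prob_fibre_pos[OF \<omega>, of f] by (simp add: ln_div)
    also have "\<dots> \<le> w (f \<omega>) / ?P (f \<omega>) - 1"
      using w[OF \<omega>] prob_fibre_pos[OF \<omega>, of f] by (intro ln_le_minus_one) simp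
    finally show "ln (w (f \<omega>)) - ln (?P (f \<omega>)) \<le> w (f \<omega>) / ?P (f \<omega>) - 1" .
  qed auto
  also have "\<dots> = (\<Sum>\<omega>\<in>set_pmf p. pmf p \<omega> * (w (f \<omega>) / ?P (f \<omega>))) - 1"
    using fin by (simp add: right_diff_distrib sum_subtractf sum_pmf_eq_1)
  also have "(\<Sum>\<omega>\<in>set_pmf p. pmf p \<omega> * (w (f \<omega>) / ?P (f \<omega>))) =
      (\<Sum>x\<in>f ` set_pmf p. \<Sum>\<omega>\<in>{\<omega> \<in> set_pmf p. f \<omega> = x}. pmf p \<omega> * (w (f \<omega>) / ?P (f \<omega>)))"
    using fin by (rule sum.image_gen)
  also have "\<dots> = (\<Sum>x\<in>f ` set_pmf p. w x)"
  proof (rule sum.cong[OF refl])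
    fix x assume "x \<in> f ` set_pmf p"
    then have "?P x > 0" by (auto simp: prob_fibre_pos)
    have "(\<Sum>\<omega>\<in>{\<omega> \<in> set_pmf p. f \<omega> = x}. pmf p \<omega> * (w (f \<omega>) / ?P (f \<omega>))) =
       (\<Sum>\<omega>\<in>{\<omega> \<in> set_pmf p. f \<omega> = x}. pmf p \<omega>) * (w x / ?P x)"
      unfolding sum_distrib_right by (intro sum.cong) auto
    then show "(\<Sum>\<omega>\<in>{\<omega> \<in> set_pmf p. f \<omega> = x}. pmf p \<omega> * (w (f \<omega>) / ?P (f \<omega>))) = w x"
      using fin \<open>?P x > 0\<close> by (simp add: sum_pmf_fibre)
  qed
  finally show ?thesis by linarith
qed

lemma entropy_of_le_ln_card:
  assumes fin: "finite B" "finite (set_pmf p)" and sub: "f ` set_pmf p \<subseteq> B"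
  shows "entropy_of p f \<le> ln (card B)"
proof -
  have "B \<noteq> {}" using sub set_pmf_not_empty[of p] by auto
  then have c: "card B > 0" using fin by auto
  have "(\<Sum>x\<in>f ` set_pmf p. 1 / real (card B)) \<le> (\<Sum>x\<in>B. 1 / real (card B))"
    using fin sub by (intro sum_mono2) auto
  also have "\<dots> = 1" using c by simp
  finally have "(\<Sum>x\<in>f ` set_pmf p. 1 / real (card B)) \<le> 1" .
  moreover have "(\<Sum>\<omega>\<in>set_pmf p. pmf p \<omega> * - ln (1 / card B)) = ln (card B)"
    using c fin(2) by (simp add: ln_div sum_distrib_right[symmetric] sum_pmf_eq_1)
  ultimately show ?thesis
    using Gibbs[OF fin(2), of "\<lambda>_. 1 / card B" f] c by (smt (verit) divide_pos_pos of_nat_0_less_iff)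
qed

lemma entropy_of_ge:
  assumes fin: "finite (set_pmf p)" and inj: "inj_on f (set_pmf p)"
    and c: "\<And>\<omega>. pmf p \<omega> \<le> c"
  shows "entropy_of p f \<ge> - ln c"
proof -
  have "entropy_of p f = entropy_of p id"
    using inj by (intro entropy_of_cong) (auto simp: inj_on_def)
  also have "\<dots> = (\<Sum>\<omega>\<in>set_pmf p. pmf p \<omega> * - ln (pmf p \<omega>))"
    by (simp add: entropy_of_def measure_pmf_single)
  also have "\<dots> \<ge> (\<Sum>\<omega>\<in>set_pmf p. pmf p \<omega> * - ln c)"
  proof (intro sum_mono mult_left_mono)
    fix \<omega> assume "\<omega> \<in> set_pmf p"
    then have "pmf p \<omega> > 0" by (simp add: pmf_positive)
    then show "- ln c \<le> - ln (pmf p \<omega>)" using c[of \<omega>] by (auto intro!: ln_mono)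
  qed auto
  finally show ?thesis using fin by (simp add: sum_negf sum_distrib_right[symmetric] sum_pmf_eq_1)
qed

text \<open>Gibbs with the product of the marginals as weight; over the jointly occurring values
  this weight has mass at most 1.\<close>

lemma entropy_of_pair_le:
  assumes fin: "finite (set_pmf p)"
  shows "entropy_of p (\<lambda>\<omega>. (f \<omega>, g \<omega>)) \<le> entropy_of p f + entropy_of p g"
proof -
  let ?P = "\<lambda>f x. measure_pmf.prob p {\<omega>'. f \<omega>' = x}"
  let ?w = "\<lambda>(x, y). ?P f x * ?P g y"
  have "(\<Sum>z\<in>(\<lambda>\<omega>. (f \<omega>, g \<omega>)) ` set_pmf p. ?w z) \<le> (\<Sum>z\<in>f ` set_pmf p \<times> g ` set_pmf p. ?w z)"
    using fin by (intro sum_mono2) auto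
  also have "\<dots> = (\<Sum>x\<in>f ` set_pmf p. ?P f x) * (\<Sum>y\<in>g ` set_pmf p. ?P g y)"
    by (simp add: sum_product sum.cartesian_product)
  also have "\<dots> = 1" using fin by (simp add: sum_prob_fibres)
  finally have le: "(\<Sum>z\<in>(\<lambda>\<omega>. (f \<omega>, g \<omega>)) ` set_pmf p. ?w z) \<le> 1" .
  have "(\<Sum>\<omega>\<in>set_pmf p. pmf p \<omega> * - ln (?w (f \<omega>, g \<omega>))) = entropy_of p f + entropy_of p g"
    unfolding entropy_of_def sum.distrib[symmetric]
    by (intro sum.cong refl) (simp add: ln_mult_pos prob_fibre_pos algebra_simps)
  moreover have "entropy_of p (\<lambda>\<omega>. (f \<omega>, g \<omega>)) \<le>
      (\<Sum>\<omega>\<in>set_pmf p. pmf p \<omega> * - ln (?w (f \<omega>, g \<omega>))) + (\<Sum>z\<in>(\<lambda>\<omega>. (f \<omega>, g \<omega>)) ` set_pmf p. ?w z) - 1"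
    using fin by (intro Gibbs) (auto simp: prob_fibre_pos)
  ultimately show ?thesis using le by linarith
qed

section \<open>Conditional entropy and submodularity\<close>

lemma measure_cond_pmf:
  assumes "set_pmf p \<inter> s \<noteq> {}"
  shows "measure_pmf.prob (cond_pmf p s) A = measure_pmf.prob p (A \<inter> s) / measure_pmf.prob p s"
proof -
  have "emeasure (measure_pmf p) s \<noteq> 0"
    using assms measure_pmf_posI[of _ p s] by (force simp: measure_pmf.emeasure_eq_measure)
  then show ?thesis
    using assms by (simp add: cond_pmf.rep_eq Int_commute)
qed

text \<open>The chain rule in the form of an average over conditional laws. It allows an inequality
  proved for an arbitrary law to be applied under every condition and then averaged.\<close>

lemma entropy_of_chain:
  assumes fin: "finite (set_pmf p)"
  shows "entropy_of p (\<lambda>\<omega>. (f \<omega>, g \<omega>)) - entropy_of p g =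
    (\<Sum>a\<in>g ` set_pmf p. measure_pmf.prob p {\<omega>. g \<omega> = a} * entropy_of (cond_pmf p {\<omega>. g \<omega> = a}) f)"
proof -
  let ?P = "\<lambda>a. measure_pmf.prob p {\<omega>. g \<omega> = a}" and ?c = "\<lambda>a. cond_pmf p {\<omega>. g \<omega> = a}"
  have "entropy_of p (\<lambda>\<omega>. (f \<omega>, g \<omega>)) - entropy_of p g =
    (\<Sum>\<omega>\<in>set_pmf p. pmf p \<omega> * (ln (?P (g \<omega>)) - ln (measure_pmf.prob p {\<omega>'. f \<omega>' = f \<omega> \<and> g \<omega>' = g \<omega>})))"
    unfolding entropy_of_def by (simp add: sum_subtractf[symmetric] algebra_simps)
  also have "\<dots> = (\<Sum>a\<in>g ` set_pmf p. \<Sum>\<omega>\<in>{\<omega> \<in> set_pmf p. g \<omega> = a}.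
      pmf p \<omega> * (ln (?P (g \<omega>)) - ln (measure_pmf.prob p {\<omega>'. f \<omega>' = f \<omega> \<and> g \<omega>' = g \<omega>})))"
    using fin by (rule sum.image_gen)
  also have "\<dots> = (\<Sum>a\<in>g ` set_pmf p. ?P a * entropy_of (?c a) f)"
  proof (rule sum.cong[OF refl])
    fix a assume "a \<in> g ` set_pmf p"
    then have ne: "set_pmf p \<inter> {\<omega>. g \<omega> = a} \<noteq> {}" and pos: "?P a > 0"
      using prob_fibre_pos by fastforce+
    have "?P a * entropy_of (?c a) f = (\<Sum>\<omega>\<in>{\<omega> \<in> set_pmf p. g \<omega> = a}.
        ?P a * (pmf (?c a) \<omega> * - ln (measure_pmf.prob (?c a) {\<omega>'. f \<omega>' = f \<omega>})))"
      unfolding entropy_of_def using ne by (simp add: sum_distrib_left set_cond_pmf Int_def)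
    also have "\<dots> = (\<Sum>\<omega>\<in>{\<omega> \<in> set_pmf p. g \<omega> = a}.
      pmf p \<omega> * (ln (?P (g \<omega>)) - ln (measure_pmf.prob p {\<omega>'. f \<omega>' = f \<omega> \<and> g \<omega>' = g \<omega>})))"
    proof (rule sum.cong[OF refl])
      fix \<omega> assume "\<omega> \<in> {\<omega> \<in> set_pmf p. g \<omega> = a}"
      then have \<omega>: "\<omega> \<in> set_pmf p" "g \<omega> = a" by auto
      have "measure_pmf.prob p {\<omega>'. f \<omega>' = f \<omega> \<and> g \<omega>' = g \<omega>} > 0"
        using \<omega> by (intro measure_pmf_posI[of \<omega>]) auto
      then show "?P a * (pmf (?c a) \<omega> * - ln (measure_pmf.prob (?c a) {\<omega>'. f \<omega>' = f \<omega>})) =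
        pmf p \<omega> * (ln (?P (g \<omega>)) - ln (measure_pmf.prob p {\<omega>'. f \<omega>' = f \<omega> \<and> g \<omega>' = g \<omega>}))"
        using \<omega> ne pos by (simp add: measure_cond_pmf pmf_cond ln_div Collect_conj_eq[symmetric])
    qed
    finally show "(\<Sum>\<omega>\<in>{\<omega> \<in> set_pmf p. g \<omega> = a}.
      pmf p \<omega> * (ln (?P (g \<omega>)) - ln (measure_pmf.prob p {\<omega>'. f \<omega>' = f \<omega> \<and> g \<omega>' = g \<omega>}))) =
       ?P a * entropy_of (?c a) f" ..
  qed
  finally show ?thesis .
qed

lemma entropy_of_pair_ge:
  assumes "finite (set_pmf p)"
  shows "entropy_of p g \<le> entropy_of p (\<lambda>\<omega>. (f \<omega>, g \<omega>))"
  using entropy_of_chain[OF assms, of f g]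
  by (smt (verit) entropy_of_nonneg measure_nonneg mult_nonneg_nonneg sum_nonneg)

text \<open>Subadditivity under each conditional law given \<open>h\<close>, averaged by the chain
  rule.\<close>

lemma entropy_of_submodular:
  assumes fin: "finite (set_pmf p)"
  shows "entropy_of p (\<lambda>\<omega>. ((f \<omega>, g \<omega>), h \<omega>)) + entropy_of p h
    \<le> entropy_of p (\<lambda>\<omega>. (f \<omega>, h \<omega>)) + entropy_of p (\<lambda>\<omega>. (g \<omega>, h \<omega>))"
proof -
  have "(\<Sum>a\<in>h ` set_pmf p. measure_pmf.prob p {\<omega>. h \<omega> = a} * entropy_of (cond_pmf p {\<omega>. h \<omega> = a}) (\<lambda>\<omega>. (f \<omega>, g \<omega>)))
    \<le> (\<Sum>a\<in>h ` set_pmf p. measure_pmf.prob p {\<omega>. h \<omega> = a} * (entropy_of (cond_pmf p {\<omega>. h \<omega> = a}) f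
        + entropy_of (cond_pmf p {\<omega>. h \<omega> = a}) g))"
  proof (intro sum_mono mult_left_mono entropy_of_pair_le)
    fix a assume "a \<in> h ` set_pmf p"
    then have "set_pmf p \<inter> {\<omega>. h \<omega> = a} \<noteq> {}" by auto
    then show "finite (set_pmf (cond_pmf p {\<omega>. h \<omega> = a}))"
      using fin by (simp add: set_cond_pmf)
  qed auto
  then show ?thesis
    by (simp add: distrib_left sum.distrib entropy_of_chain[OF fin, symmetric])
qed

section \<open>Almost independent sides of a triangle\<close>

lemma sum_prob_fibres_Int:
  assumes "finite (set_pmf p)"
  shows "(\<Sum>x\<in>f ` set_pmf p \<inter> A. measure_pmf.prob p {\<omega>. f \<omega> = x}) = measure_pmf.prob p {\<omega>. f \<omega> \<in> A}"
proof -
  have "measure_pmf.prob p {\<omega>. f \<omega> \<in> A} = measure_pmf.prob (map_pmf f p) A"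
    by (simp add: vimage_def)
  also have "\<dots> = measure_pmf.prob (map_pmf f p) (f ` set_pmf p \<inter> A)"
    by (intro measure_pmf.finite_measure_eq_AE) (auto simp: AE_measure_pmf_iff)
  also have "\<dots> = (\<Sum>x\<in>f ` set_pmf p \<inter> A. measure_pmf.prob p {\<omega>. f \<omega> = x})"
    using assms by (subst measure_measure_pmf_finite) (auto simp: pmf_map vimage_def)
  finally show ?thesis ..
qed

text \<open>Gibbs with the product of the three marginals as weight. The joint support misses the
  box \<open>A \<times> B \<times> C\<close>, so the weight has mass at most 1 minus the product
  measure of that box, and this deficit survives as the bound.\<close>

lemma total_correlation_ge:
  assumes fin: "finite (set_pmf p)"
    and disj: "\<And>\<omega>. \<omega> \<in> set_pmf p \<Longrightarrow> \<not> (X \<omega> \<in> A \<and> Y \<omega> \<in> B \<and> Z \<omega> \<in> C)"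
  shows "measure_pmf.prob p {\<omega>. X \<omega> \<in> A} * measure_pmf.prob p {\<omega>. Y \<omega> \<in> B} * measure_pmf.prob p {\<omega>. Z \<omega> \<in> C}
    \<le> entropy_of p X + entropy_of p Y + entropy_of p Z - entropy_of p (\<lambda>\<omega>. (X \<omega>, Y \<omega>, Z \<omega>))"
proof -
  let ?S = "set_pmf p"
  let ?P = "\<lambda>f x. measure_pmf.prob p {\<omega>'. f \<omega>' = x}"
  let ?w = "\<lambda>(x, y, z). ?P X x * ?P Y y * ?P Z z"
  let ?U = "X ` ?S \<times> Y ` ?S \<times> Z ` ?S" and ?V = "(X ` ?S \<inter> A) \<times> (Y ` ?S \<inter> B) \<times> (Z ` ?S \<inter> C)"
  have prod: "sum ?w (I \<times> J \<times> K) = (\<Sum>x\<in>I. ?P X x) * (\<Sum>x\<in>J. ?P Y x) * (\<Sum>x\<in>K. ?P Z x)" for I J K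
    by (simp add: sum_product sum.cartesian_product[symmetric] sum_distrib_left sum_distrib_right mult_ac)
       (rule sum.swap)
  have "sum ?w ((\<lambda>\<omega>. (X \<omega>, Y \<omega>, Z \<omega>)) ` ?S) \<le> sum ?w (?U - ?V)"
    using fin disj by (intro sum_mono2) auto
  also have "\<dots> = sum ?w ?U - sum ?w ?V"
    using fin by (intro sum_diff) auto
  also have "\<dots> = 1 - measure_pmf.prob p {\<omega>. X \<omega> \<in> A} * measure_pmf.prob p {\<omega>. Y \<omega> \<in> B} * measure_pmf.prob p {\<omega>. Z \<omega> \<in> C}"
    using fin by (simp only: prod sum_prob_fibres sum_prob_fibres_Int)
  finally have "sum ?w ((\<lambda>\<omega>. (X \<omega>, Y \<omega>, Z \<omega>)) ` ?S) \<le> \<dots>" .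
  moreover have "(\<Sum>\<omega>\<in>?S. pmf p \<omega> * - ln (?w (X \<omega>, Y \<omega>, Z \<omega>))) = entropy_of p X + entropy_of p Y + entropy_of p Z"
    unfolding entropy_of_def sum.distrib[symmetric]
    by (intro sum.cong refl) (simp add: ln_mult_pos prob_fibre_pos algebra_simps)
  moreover have "entropy_of p (\<lambda>\<omega>. (X \<omega>, Y \<omega>, Z \<omega>)) \<le>
      (\<Sum>\<omega>\<in>?S. pmf p \<omega> * - ln (?w (X \<omega>, Y \<omega>, Z \<omega>))) + sum ?w ((\<lambda>\<omega>. (X \<omega>, Y \<omega>, Z \<omega>)) ` ?S) - 1"
    using fin by (intro Gibbs) (auto simp: prob_fibre_pos)
  ultimately show ?thesis by linarith
qed

lemma prob_fibre_pos_iff: "measure_pmf.prob p {\<omega>. f \<omega> = x} > 0 \<longleftrightarrow> x \<in> f ` set_pmf p"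
  by (auto simp: measure_pmf_zero_iff zero_less_measure_iff)

text \<open>Both sides of the quantile are needed: the mass above \<open>\<beta>\<close> feeds
  \<open>total_correlation_ge\<close>, and the mass at most \<open>\<beta>\<close> bounds what lies
  outside the entropy window.\<close>

lemma lower_quantile:
  fixes X :: "'w \<Rightarrow> nat"
  assumes fin: "finite (set_pmf p)" and \<beta>: "0 \<le> \<beta>" "\<beta> < 1"
  obtains t where "t \<in> X ` set_pmf p" "measure_pmf.prob p {\<omega>. X \<omega> \<le> t} > \<beta>" "measure_pmf.prob p {\<omega>. X \<omega> < t} \<le> \<beta>"
proof -
  let ?Q = "\<lambda>t. measure_pmf.prob p {\<omega>. X \<omega> \<le> t} > \<beta>"
  have "measure_pmf.prob p {\<omega>. X \<omega> \<le> Max (X ` set_pmf p)} = 1"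
    using fin by (subst measure_pmf.prob_eq_1) (auto simp: AE_measure_pmf_iff)
  then have ex: "?Q (Max (X ` set_pmf p))" using \<beta> by simp
  define t where "t = (LEAST t. ?Q t)"
  have 1: "?Q t" unfolding t_def by (rule LeastI) (rule ex)
  have 2: "measure_pmf.prob p {\<omega>. X \<omega> < t} \<le> \<beta>"
  proof (cases t)
    case (Suc s)
    then have "\<not> ?Q s" using not_less_Least[of s ?Q] by (simp add: t_def)
    then show ?thesis using Suc by (simp add: less_Suc_eq_le)
  qed (simp add: \<beta>)
  have "measure_pmf.prob p {\<omega>. X \<omega> \<le> t} = measure_pmf.prob p {\<omega>. X \<omega> < t} + measure_pmf.prob p {\<omega>. X \<omega> = t}"
    by (subst measure_pmf.finite_measure_Union[symmetric]) (auto intro!: arg_cong[of _ _ "measure_pmf.prob p"])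
  with 1 2 have "t \<in> X ` set_pmf p" by (subst prob_fibre_pos_iff[symmetric]) linarith
  with 1 2 that show ?thesis by blast
qed

text \<open>Reflection at the maximum \<open>?M\<close> of the support. The truncated subtraction is
  faithful only on the support, so the events are compared almost surely.\<close>

lemma upper_quantile:
  fixes X :: "'w \<Rightarrow> nat"
  assumes fin: "finite (set_pmf p)" and \<beta>: "0 \<le> \<beta>" "\<beta> < 1"
  obtains t where "t \<in> X ` set_pmf p" "measure_pmf.prob p {\<omega>. t \<le> X \<omega>} > \<beta>" "measure_pmf.prob p {\<omega>. t < X \<omega>} \<le> \<beta>"
proof -
  let ?M = "Max (X ` set_pmf p)"
  have le: "X \<omega> \<le> ?M" if "\<omega> \<in> set_pmf p" for \<omega> using fin that by simp
  obtain t where t: "t \<in> (\<lambda>x. ?M - x) ` X ` set_pmf p" "measure_pmf.prob p {\<omega>. ?M - X \<omega> \<le> t} > \<beta>"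
     "measure_pmf.prob p {\<omega>. ?M - X \<omega> < t} \<le> \<beta>"
    using lower_quantile[OF assms, of "\<lambda>\<omega>. ?M - X \<omega>"] by (auto simp: image_image)
  then have "?M - t \<in> X ` set_pmf p" using le by auto
  moreover have "t \<le> ?M" using t(1) by auto
  then have "measure_pmf.prob p {\<omega>. ?M - X \<omega> \<le> t} = measure_pmf.prob p {\<omega>. ?M - t \<le> X \<omega>}"
    by (intro measure_pmf.finite_measure_eq_AE) (auto simp: AE_measure_pmf_iff dest: le)
  moreover have "measure_pmf.prob p {\<omega>. ?M - X \<omega> < t} = measure_pmf.prob p {\<omega>. ?M - t < X \<omega>}"
    using \<open>t \<le> ?M\<close> by (intro measure_pmf.finite_measure_eq_AE) (auto simp: AE_measure_pmf_iff dest: le)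
  ultimately show ?thesis using that[of "?M - t"] t by simp
qed

text \<open>Gibbs with a mixture as weight: \<open>1 - \<beta>\<close> uniform on the window plus
  \<open>\<beta>\<close> uniform on \<open>{1..K}\<close>. Inside the window the mixture costs at
  most \<open>2 * \<beta>\<close> more than \<open>ln l\<close>; outside, where the mass is at most
  \<open>2 * \<beta>\<close>, it costs \<open>ln (K / \<beta>)\<close>.\<close>

lemma entropy_of_le_window:
  fixes X :: "'w \<Rightarrow> nat"
  assumes fin: "finite (set_pmf p)" and \<beta>: "0 < \<beta>" "\<beta> \<le> 1 / 4"
    and X: "X ` set_pmf p \<subseteq> {1..K}" and ab: "1 \<le> a" "a \<le> b" "b \<le> K"
    and out: "measure_pmf.prob p {\<omega>. X \<omega> < a} \<le> \<beta>" "measure_pmf.prob p {\<omega>. b < X \<omega>} \<le> \<beta>"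
  shows "entropy_of p X \<le> ln (real b - real a + 1) + 2 * \<beta> + 2 * \<beta> * ln (K / \<beta>)"
proof -
  define l where "l = real b - real a + 1"
  have l: "l \<ge> 1" using ab by (simp add: l_def)
  have K: "real K \<ge> 1" using ab by simp
  have lnK: "ln (K / \<beta>) \<ge> 0" using \<beta> K by (intro ln_ge_zero) (simp add: field_simps)
  define w where "w t = (if t \<in> {a..b} then (1 - \<beta>) / l else 0) + \<beta> / K" for t
  have wpos: "w t > 0" for t using \<beta> l K by (auto simp: w_def intro!: add_nonneg_pos)
  have "(\<Sum>t\<in>X ` set_pmf p. w t) \<le> (\<Sum>t\<in>{1..K}. w t)"
    using X wpos by (intro sum_mono2) (auto intro: less_imp_le)
  also have "\<dots> = (\<Sum>t\<in>{1..K} \<inter> {a..b}. (1 - \<beta>) / l) + \<beta>"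
    unfolding w_def sum.distrib using K by (subst sum.inter_restrict) auto
  also have "{1..K} \<inter> {a..b} = {a..b}" using ab by auto
  also have "(\<Sum>t\<in>{a..b}. (1 - \<beta>) / l) + \<beta> = l * ((1 - \<beta>) / l) + \<beta>"
  proof -
    have "real (card {a..b}) = l" using ab by (simp add: l_def of_nat_diff Suc_diff_le)
    then show ?thesis by simp
  qed
  also have "\<dots> = 1" using l by simp
  finally have sum_w: "(\<Sum>t\<in>X ` set_pmf p. w t) \<le> 1" .
  have "- ln (w t) \<le> ln l + 2 * \<beta> + (if t \<in> {a..b} then 0 else ln (K / \<beta>))" for t
  proof (cases "t \<in> {a..b}")
    case True
    have "ln ((1 - \<beta>) / l) \<le> ln (w t)" using True \<beta> l K by (intro ln_mono) (auto simp: w_def)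
    moreover have "ln ((1 - \<beta>) / l) = ln (1 - \<beta>) - ln l" using \<beta> l by (simp add: ln_div)
    moreover have "- ln (1 - \<beta>) \<le> 2 * \<beta>"
    proof -
      have "- ln (1 - \<beta>) = ln (1 / (1 - \<beta>))" using \<beta> by (simp add: ln_div)
      also have "\<dots> \<le> 1 / (1 - \<beta>) - 1" using \<beta> by (intro ln_le_minus_one) auto
      also have "\<dots> \<le> 2 * \<beta>"
      proof -
        have "1 \<le> (1 + 2 * \<beta>) * (1 - \<beta>)" using \<beta> by (simp add: algebra_simps)
        then have "1 / (1 - \<beta>) \<le> 1 + 2 * \<beta>" using \<beta> by (subst pos_divide_le_eq) auto
        then show ?thesis by linarith
      qed
      finally show ?thesis .
    qed
    ultimately show ?thesis using True by simp
  next
    case False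
    have "ln (w t) = - ln (K / \<beta>)" using False \<beta> K by (auto simp: w_def ln_div)
    then show ?thesis using l \<beta> by (simp only: False if_False) (simp add: add_nonneg_nonneg)
  qed
  then have "(\<Sum>\<omega>\<in>set_pmf p. pmf p \<omega> * - ln (w (X \<omega>))) \<le>
      (\<Sum>\<omega>\<in>set_pmf p. pmf p \<omega> * (ln l + 2 * \<beta> + (if X \<omega> \<in> {a..b} then 0 else ln (K / \<beta>))))"
    by (intro sum_mono mult_left_mono) auto
  also have "\<dots> = ln l + 2 * \<beta> + (\<Sum>\<omega>\<in>set_pmf p. if X \<omega> \<in> {a..b} then 0 else pmf p \<omega>) * ln (K / \<beta>)"
  proof -
    have "(\<Sum>\<omega>\<in>set_pmf p. pmf p \<omega> * (ln l + 2 * \<beta> + (if X \<omega> \<in> {a..b} then 0 else ln (K / \<beta>)))) =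
      (\<Sum>\<omega>\<in>set_pmf p. pmf p \<omega> * (ln l + 2 * \<beta>)) + (\<Sum>\<omega>\<in>set_pmf p. (if X \<omega> \<in> {a..b} then 0 else pmf p \<omega>) * ln (K / \<beta>))"
      unfolding sum.distrib[symmetric] by (intro sum.cong) (auto simp: algebra_simps)
    then show ?thesis by (simp only: sum_distrib_right[symmetric] sum_pmf_eq_1[OF fin order_refl] mult_1)
  qed
  also have "(\<Sum>\<omega>\<in>set_pmf p. if X \<omega> \<in> {a..b} then 0 else pmf p \<omega>) = measure_pmf.prob p {\<omega> \<in> set_pmf p. X \<omega> \<notin> {a..b}}"
    using fin by (simp add: measure_measure_pmf_finite sum.If_cases Int_def)
  also have "\<dots> \<le> measure_pmf.prob p ({\<omega>. X \<omega> < a} \<union> {\<omega>. b < X \<omega>})"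
    by (intro measure_pmf.finite_measure_mono) auto
  also have "\<dots> \<le> 2 * \<beta>"
    using measure_Un_le[of "{\<omega>. X \<omega> < a}" "measure_pmf p" "{\<omega>. b < X \<omega>}"] out by simp
  finally have "(\<Sum>\<omega>\<in>set_pmf p. pmf p \<omega> * - ln (w (X \<omega>))) \<le> ln l + 2 * \<beta> + 2 * \<beta> * ln (K / \<beta>)"
    using lnK by (simp add: mult_right_mono)
  with Gibbs[OF fin, of w X] wpos sum_w show ?thesis unfolding l_def by fastforce
qed

text \<open>If the total correlation is below \<open>\<beta>\<^sup>3\<close>, the \<open>\<beta>\<close>-quantiles satisfy \<open>x2 \<le> y1 + z1\<close> and its two analogues.
  With \<open>x2, y2, z2 \<le> 2 R\<close> the three windows then have total length at most \<open>3 R - \<bar>R - x1\<bar>\<close>,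
  and \<open>ln u \<le> u - 1\<close> gives the bound. Otherwise the last term pays for the trivial bound \<open>3 ln (2 R) + 1\<close>.\<close>

lemma triangle_entropy_bound:
  fixes X Y Z :: "'w \<Rightarrow> nat" and R :: nat and \<beta> \<eta> :: real
  assumes fin: "finite (set_pmf p)" and R: "R \<ge> 1" and \<beta>: "0 < \<beta>" "\<beta> \<le> 1 / 4" and \<eta>: "0 \<le> \<eta>" "\<eta> \<le> 1"
    and range: "X ` set_pmf p \<subseteq> {1..2 * R}" "Y ` set_pmf p \<subseteq> {1..2 * R}" "Z ` set_pmf p \<subseteq> {1..2 * R}"
    and tri: "\<And>\<omega>. \<omega> \<in> set_pmf p \<Longrightarrow> X \<omega> \<le> Y \<omega> + Z \<omega>" "\<And>\<omega>. \<omega> \<in> set_pmf p \<Longrightarrow> Y \<omega> \<le> X \<omega> + Z \<omega>"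
      "\<And>\<omega>. \<omega> \<in> set_pmf p \<Longrightarrow> Z \<omega> \<le> X \<omega> + Y \<omega>"
  shows "entropy_of p X + entropy_of p Y + entropy_of p Z + \<eta> * measure_pmf.prob p {\<omega>. X \<omega> < (1 - \<eta>) * R}
    \<le> 3 * ln R + (3 / R + 7 * \<beta> + 6 * \<beta> * ln (2 * R / \<beta>)) +
      4 / \<beta> ^ 3 * (entropy_of p X + entropy_of p Y + entropy_of p Z - entropy_of p (\<lambda>\<omega>. (X \<omega>, Y \<omega>, Z \<omega>)))"
    (is "?H + \<eta> * ?p \<le> 3 * ln R + ?e + 4 / \<beta> ^ 3 * ?T")
proof -
  have R1: "real R \<ge> 1" using R by simp
  have lnR: "ln (2 * R / \<beta>) \<ge> 0" using \<beta> R1 by (intro ln_ge_zero) (simp add: field_simps)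
  have e: "?e \<ge> 0" using \<beta> R1 lnR by (intro add_nonneg_nonneg) auto
  have T: "?T \<ge> 0" using total_correlation_ge[OF fin, of X "{}" Y "{}" Z "{}"] by simp
  show ?thesis
  proof (cases "?T < \<beta> ^ 3")
    case False
    have "entropy_of p X \<le> ln (2 * R)" "entropy_of p Y \<le> ln (2 * R)" "entropy_of p Z \<le> ln (2 * R)"
      using entropy_of_le_ln_card[OF _ fin range(1)] entropy_of_le_ln_card[OF _ fin range(2)]
        entropy_of_le_ln_card[OF _ fin range(3)] by simp_all
    moreover have "ln (real (2 * R)) \<le> ln R + 1" using R1 ln_2_less_1 by (simp add: ln_mult)
    moreover have "\<eta> * ?p \<le> 1 * 1" using \<eta> by (intro mult_mono) auto
    moreover have "4 / \<beta> ^ 3 * ?T \<ge> 4 / \<beta> ^ 3 * \<beta> ^ 3" using False \<beta> by (intro mult_left_mono) auto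
    then have "4 / \<beta> ^ 3 * ?T \<ge> 4" using \<beta> by simp
    ultimately show ?thesis using e by linarith
  next
    case True
    have b1: "0 \<le> \<beta>" "\<beta> < 1" using \<beta> by auto
    \<comment> \<open>If \<open>u2 > v1 + w1\<close>, the triangle inequality forbids
      \<open>U \<ge> u2\<close>, \<open>V \<le> v1\<close>, \<open>W \<le> w1\<close> at once,
      although each event has probability above \<open>\<beta>\<close>. The total correlation would
      then be at least \<open>\<beta> ^ 3\<close>.\<close>
    have separated: "u2 \<le> v1 + w1"
      if "measure_pmf.prob p {\<omega>. u2 \<le> U \<omega>} > \<beta>" "measure_pmf.prob p {\<omega>. V \<omega> \<le> v1} > \<beta>"
        "measure_pmf.prob p {\<omega>. W \<omega> \<le> w1} > \<beta>"
        and t: "\<And>\<omega>. \<omega> \<in> set_pmf p \<Longrightarrow> U \<omega> \<le> V \<omega> + W \<omega>"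
        and T': "entropy_of p U + entropy_of p V + entropy_of p W - entropy_of p (\<lambda>\<omega>. (U \<omega>, V \<omega>, W \<omega>)) < \<beta> ^ 3"
      for U V W :: "'w \<Rightarrow> nat" and u2 v1 w1
    proof (rule ccontr)
      assume "\<not> u2 \<le> v1 + w1"
      then have "\<not> (U \<omega> \<in> {u2..} \<and> V \<omega> \<in> {..v1} \<and> W \<omega> \<in> {..w1})" if "\<omega> \<in> set_pmf p" for \<omega>
        using t[OF that] by auto
      from total_correlation_ge[OF fin this, of "\<lambda>\<omega>. \<omega>"] T'
      have "measure_pmf.prob p {\<omega>. u2 \<le> U \<omega>} * measure_pmf.prob p {\<omega>. V \<omega> \<le> v1} *
          measure_pmf.prob p {\<omega>. W \<omega> \<le> w1} < \<beta> ^ 3" by (simp add: atLeast_def atMost_def)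
      moreover have "\<beta> * \<beta> * \<beta> \<le> measure_pmf.prob p {\<omega>. u2 \<le> U \<omega>} * measure_pmf.prob p {\<omega>. V \<omega> \<le> v1} *
          measure_pmf.prob p {\<omega>. W \<omega> \<le> w1}"
        using that(1-3) \<beta> by (intro mult_mono) auto
      ultimately show False by (simp add: power3_eq_cube)
    qed
    have perm: "entropy_of p (\<lambda>\<omega>. (Y \<omega>, X \<omega>, Z \<omega>)) = entropy_of p (\<lambda>\<omega>. (X \<omega>, Y \<omega>, Z \<omega>))"
      "entropy_of p (\<lambda>\<omega>. (Z \<omega>, X \<omega>, Y \<omega>)) = entropy_of p (\<lambda>\<omega>. (X \<omega>, Y \<omega>, Z \<omega>))"
      by (intro entropy_of_cong; auto)+
    obtain x1 where x1: "x1 \<in> X ` set_pmf p" "measure_pmf.prob p {\<omega>. X \<omega> \<le> x1} > \<beta>" "measure_pmf.prob p {\<omega>. X \<omega> < x1} \<le> \<beta>"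
      using lower_quantile[OF fin b1] by blast
    obtain y1 where y1: "y1 \<in> Y ` set_pmf p" "measure_pmf.prob p {\<omega>. Y \<omega> \<le> y1} > \<beta>" "measure_pmf.prob p {\<omega>. Y \<omega> < y1} \<le> \<beta>"
      using lower_quantile[OF fin b1] by blast
    obtain z1 where z1: "z1 \<in> Z ` set_pmf p" "measure_pmf.prob p {\<omega>. Z \<omega> \<le> z1} > \<beta>" "measure_pmf.prob p {\<omega>. Z \<omega> < z1} \<le> \<beta>"
      using lower_quantile[OF fin b1] by blast
    obtain x2 where x2: "x2 \<in> X ` set_pmf p" "measure_pmf.prob p {\<omega>. x2 \<le> X \<omega>} > \<beta>" "measure_pmf.prob p {\<omega>. x2 < X \<omega>} \<le> \<beta>"
      using upper_quantile[OF fin b1] by blast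
    obtain y2 where y2: "y2 \<in> Y ` set_pmf p" "measure_pmf.prob p {\<omega>. y2 \<le> Y \<omega>} > \<beta>" "measure_pmf.prob p {\<omega>. y2 < Y \<omega>} \<le> \<beta>"
      using upper_quantile[OF fin b1] by blast
    obtain z2 where z2: "z2 \<in> Z ` set_pmf p" "measure_pmf.prob p {\<omega>. z2 \<le> Z \<omega>} > \<beta>" "measure_pmf.prob p {\<omega>. z2 < Z \<omega>} \<le> \<beta>"
      using upper_quantile[OF fin b1] by blast
    have T2: "entropy_of p Y + entropy_of p X + entropy_of p Z - entropy_of p (\<lambda>\<omega>. (Y \<omega>, X \<omega>, Z \<omega>)) < \<beta> ^ 3"
      "entropy_of p Z + entropy_of p X + entropy_of p Y - entropy_of p (\<lambda>\<omega>. (Z \<omega>, X \<omega>, Y \<omega>)) < \<beta> ^ 3"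
      using True unfolding perm by linarith+
    have le: "x2 \<le> y1 + z1" "y2 \<le> x1 + z1" "z2 \<le> x1 + y1"
      by (rule separated[OF x2(2) y1(2) z1(2) tri(1) True] separated[OF y2(2) x1(2) z1(2) tri(2) T2(1)]
          separated[OF z2(2) x1(2) y1(2) tri(3) T2(2)]; assumption)+
    have order: "u1 \<le> u2" if "measure_pmf.prob p {\<omega>. U \<omega> < u1} \<le> \<beta>" "measure_pmf.prob p {\<omega>. u2 < U \<omega>} \<le> \<beta>"
      for U :: "'w \<Rightarrow> nat" and u1 u2
    proof (rule ccontr)
      assume "\<not> u1 \<le> u2"
      then have "{\<omega>. U \<omega> < u1} \<union> {\<omega>. u2 < U \<omega>} = UNIV" by auto
      then show False
        using measure_Un_le[of "{\<omega>. U \<omega> < u1}" "measure_pmf p" "{\<omega>. u2 < U \<omega>}"] that \<beta> by simp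
    qed
    have o: "x1 \<le> x2" "y1 \<le> y2" "z1 \<le> z2" using order x1 x2 y1 y2 z1 z2 by blast+
    have H: "entropy_of p U \<le> ln R + ((real u2 - real u1 + 1) / R - 1) + 2 * \<beta> + 2 * \<beta> * ln (2 * R / \<beta>)"
      if "U ` set_pmf p \<subseteq> {1..2 * R}" "u1 \<in> U ` set_pmf p" "u2 \<in> U ` set_pmf p" "u1 \<le> u2"
        "measure_pmf.prob p {\<omega>. U \<omega> < u1} \<le> \<beta>" "measure_pmf.prob p {\<omega>. u2 < U \<omega>} \<le> \<beta>"
      for U :: "'w \<Rightarrow> nat" and u1 u2
    proof -
      have "entropy_of p U \<le> ln (real u2 - real u1 + 1) + 2 * \<beta> + 2 * \<beta> * ln (2 * R / \<beta>)"
      proof -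
        have "u1 \<in> {1..2 * R}" "u2 \<in> {1..2 * R}" using that(1-3) by blast+
        then show ?thesis using entropy_of_le_window[OF fin \<beta> that(1) _ that(4) _ that(5,6)] by simp
      qed
      moreover have "ln (real u2 - real u1 + 1) = ln R + ln ((real u2 - real u1 + 1) / R)"
        using R1 that(4) by (subst ln_div) auto
      moreover have "ln ((real u2 - real u1 + 1) / R) \<le> (real u2 - real u1 + 1) / R - 1"
        using R1 that(4) by (intro ln_le_minus_one) auto
      ultimately show ?thesis by linarith
    qed
    have "?H \<le> 3 * ln R + (((real x2 - real x1 + 1) / R - 1) + ((real y2 - real y1 + 1) / R - 1) + ((real z2 - real z1 + 1) / R - 1))
       + 6 * \<beta> + 6 * \<beta> * ln (2 * R / \<beta>)"
      using H[OF range(1) x1(1) x2(1) o(1) x1(3) x2(3)] H[OF range(2) y1(1) y2(1) o(2) y1(3) y2(3)]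
        H[OF range(3) z1(1) z2(1) o(3) z1(3) z2(3)] by linarith
    also have "((real x2 - real x1 + 1) / R - 1) + ((real y2 - real y1 + 1) / R - 1) + ((real z2 - real z1 + 1) / R - 1)
      = 3 / R + ((real x2 - real x1) + (real y2 - real y1) + (real z2 - real z1) - 3 * R) / R"
      using R1 by (simp add: field_simps)
    \<comment> \<open>For \<open>x1 \<le> R\<close> use \<open>x2 \<le> 2 * R\<close> with the
      triangle bounds on \<open>y2\<close> and \<open>z2\<close>; for \<open>x1 \<ge> R\<close> use
      the triangle bound on \<open>x2\<close> with \<open>y2, z2 \<le> 2 * R\<close>.\<close>
    also have "(real x2 - real x1) + (real y2 - real y1) + (real z2 - real z1) - 3 * R \<le> - \<bar>R - real x1\<bar>"
    proof -
      have "x2 \<le> 2 * R" "y2 \<le> 2 * R" "z2 \<le> 2 * R" using range x2(1) y2(1) z2(1) by auto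
      then have "real x2 \<le> 2 * R" "real y2 \<le> 2 * R" "real z2 \<le> 2 * R"
        "real x2 \<le> real y1 + real z1" "real y2 \<le> real x1 + real z1" "real z2 \<le> real x1 + real y1"
        using le by linarith+
      then show ?thesis by linarith
    qed
    finally have main: "?H \<le> 3 * ln R + (3 / R + - \<bar>R - real x1\<bar> / R) + 6 * \<beta> + 6 * \<beta> * ln (2 * R / \<beta>)"
      using R1 by (simp add: divide_right_mono)
    \<comment> \<open>Either the quantile \<open>x1\<close> lies left of
      \<open>(1 - \<eta>) * R\<close>, and its distance from \<open>R\<close> pays for
      \<open>\<eta>\<close>, or the event lies below the quantile and has mass at most
      \<open>\<beta>\<close>. This \<open>\<beta>\<close> is the seventh in the final bound.\<close>
    have "\<eta> * ?p \<le> \<beta> + \<bar>R - real x1\<bar> / R"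
    proof (cases "real x1 < (1 - \<eta>) * R")
      case True
      then have "\<eta> \<le> \<bar>R - real x1\<bar> / R" using R1 by (simp add: le_divide_eq algebra_simps)
      moreover have "\<eta> * ?p \<le> \<eta> * 1" using \<eta> by (intro mult_left_mono) auto
      ultimately show ?thesis using \<beta> by linarith
    next
      case False
      have "?p \<le> measure_pmf.prob p {\<omega>. X \<omega> < x1}"
        using False by (intro measure_pmf.finite_measure_mono) auto
      then have "?p \<le> \<beta>" using x1(3) by linarith
      moreover have "\<eta> * ?p \<le> 1 * ?p" using \<eta> by (intro mult_right_mono) auto
      moreover have "\<bar>R - real x1\<bar> / R \<ge> 0" by simp
      ultimately show ?thesis by linarith
    qed
    moreover have "4 / \<beta> ^ 3 * ?T \<ge> 0" using T \<beta> by simp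
    moreover have "- \<bar>R - real x1\<bar> / R = - (\<bar>R - real x1\<bar> / R)" by (rule minus_divide_left[symmetric])
    ultimately show ?thesis using main by linarith
  qed
qed

section \<open>Exchangeable discrete metrics\<close>

text \<open>Above \<open>k\<close> at most \<open>(1 - \<gamma>) * R\<close> values remain, too few
  to carry entropy \<open>ln R\<close>. The Gibbs weight puts \<open>\<gamma> / 2\<close> uniformly
  on \<open>{1..k}\<close> and the rest on the upper values: an outcome above \<open>k\<close> falls
  short of \<open>ln R\<close> by \<open>\<gamma> / 2\<close>, and one below exceeds it by less than
  \<open>4 / \<gamma>\<close>, so the mass below must compensate.\<close>

lemma entropy_lower_mass:
  fixes X :: "'w \<Rightarrow> nat" and R k :: nat and \<gamma> :: real
  assumes fin: "finite (set_pmf p)" and X: "X ` set_pmf p \<subseteq> {1..2 * R}" and H: "entropy_of p X \<ge> ln R"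
    and \<gamma>: "0 < \<gamma>" "\<gamma> \<le> 1" and k: "(1 + \<gamma>) * R \<le> k" "k < 2 * R"
  shows "measure_pmf.prob p {\<omega>. X \<omega> \<le> k} \<ge> \<gamma>\<^sup>2 / 8"
proof -
  let ?P = "measure_pmf.prob p {\<omega>. X \<omega> \<le> k}"
  have R: "real R > 0" using k by (cases R) auto
  have "real k > 0" using k(1) R \<gamma> by (smt (verit) mult_pos_pos)
  then have k0: "k > 0" by simp
  define w where "w t = (if t \<le> k then \<gamma> / 2 / k else (1 - \<gamma> / 2) / (2 * R - k))" for t :: nat
  have wpos: "w t > 0" for t using \<gamma> k k0 by (auto simp: w_def)
  have "(\<Sum>t\<in>X ` set_pmf p. w t) \<le> (\<Sum>t\<in>{1..2 * R}. w t)"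
    using X wpos by (intro sum_mono2) (auto intro: less_imp_le)
  also have "{1..2 * R} = {1..k} \<union> {k<..2 * R}" using k k0 by auto
  also have "(\<Sum>t\<in>\<dots>. w t) = (\<Sum>t\<in>{1..k}. \<gamma> / 2 / k) + (\<Sum>t\<in>{k<..2 * R}. (1 - \<gamma> / 2) / (2 * R - k))"
    by (subst sum.union_disjoint) (auto simp: w_def intro!: arg_cong2[of _ _ _ _ "(+)"] sum.cong)
  also have "\<dots> = 1"
    using k k0 by (simp add: of_nat_diff)
  finally have sum_w: "(\<Sum>t\<in>X ` set_pmf p. w t) \<le> 1" .
  have low: "- ln (w t) \<le> ln R + 4 / \<gamma> - 1" if "t \<le> k" for t
  proof -
    have "- ln (w t) = ln (k / (\<gamma> / 2))" using that \<gamma> k0 by (simp add: w_def ln_div)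
    also have "\<dots> \<le> ln (R * (4 / \<gamma>))" using k k0 \<gamma> by (intro ln_mono) (auto simp: field_simps)
    also have "\<dots> = ln R + ln (4 / \<gamma>)" using R \<gamma> by (intro ln_mult_pos) auto
    also have "ln (4 / \<gamma>) \<le> 4 / \<gamma> - 1" using \<gamma> by (intro ln_le_minus_one) auto
    finally show ?thesis by simp
  qed
  have high: "- ln (w t) \<le> ln R - \<gamma> / 2" if "\<not> t \<le> k" for t
  proof -
    have d: "real (2 * R - k) = 2 * R - real k" using k by simp
    have "- ln (w t) = ln ((2 * R - real k) / (1 - \<gamma> / 2))" using that \<gamma> k d by (simp add: w_def ln_div)
    also have "\<dots> \<le> ln (R * (1 - \<gamma> / 2))"
    proof (intro ln_mono)
      have "2 * R - real k \<le> R * (1 - \<gamma>)" using k(1) by (simp add: algebra_simps)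
      \<comment> \<open>One factor cancels the numerator of the weight; the other remains as the
        deficit.\<close>
      also have "\<dots> \<le> R * ((1 - \<gamma> / 2) * (1 - \<gamma> / 2))" using R by (intro mult_left_mono) (auto simp: algebra_simps)
      finally show "(2 * R - real k) / (1 - \<gamma> / 2) \<le> R * (1 - \<gamma> / 2)"
        using \<gamma> by (simp add: pos_divide_le_eq mult.assoc)
    qed (use k \<gamma> in \<open>auto simp: divide_pos_pos\<close>)
    also have "\<dots> = ln R + ln (1 - \<gamma> / 2)" using R \<gamma> by (intro ln_mult_pos) auto
    also have "ln (1 - \<gamma> / 2) \<le> - (\<gamma> / 2)" using ln_le_minus_one[of "1 - \<gamma> / 2"] \<gamma> by simp
    finally show ?thesis by simp
  qed
  have "(\<Sum>\<omega>\<in>set_pmf p. pmf p \<omega> * - ln (w (X \<omega>))) \<le>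
      (\<Sum>\<omega>\<in>set_pmf p. pmf p \<omega> * (ln R - \<gamma> / 2) + (if X \<omega> \<le> k then pmf p \<omega> else 0) * (4 / \<gamma> - 1 + \<gamma> / 2))"
  proof (rule sum_mono)
    fix \<omega> assume "\<omega> \<in> set_pmf p"
    show "pmf p \<omega> * - ln (w (X \<omega>)) \<le> pmf p \<omega> * (ln R - \<gamma> / 2) + (if X \<omega> \<le> k then pmf p \<omega> else 0) * (4 / \<gamma> - 1 + \<gamma> / 2)"
    proof (cases "X \<omega> \<le> k")
      case True
      then show ?thesis using mult_left_mono[OF low[OF True], of "pmf p \<omega>"] by (simp add: algebra_simps)
    next
      case False
      then show ?thesis using mult_left_mono[OF high[OF False], of "pmf p \<omega>"] by simp
    qed
  qed
  also have "\<dots> = (ln R - \<gamma> / 2) + (\<Sum>\<omega>\<in>set_pmf p. if X \<omega> \<le> k then pmf p \<omega> else 0) * (4 / \<gamma> - 1 + \<gamma> / 2)"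
    by (simp only: sum.distrib sum_distrib_right[symmetric] sum_pmf_eq_1[OF fin order_refl] mult_1)
  also have "(\<Sum>\<omega>\<in>set_pmf p. if X \<omega> \<le> k then pmf p \<omega> else 0) = measure_pmf.prob p {\<omega> \<in> set_pmf p. X \<omega> \<le> k}"
    using fin by (simp add: measure_measure_pmf_finite sum.If_cases Int_def)
  also have "measure_pmf.prob p {\<omega> \<in> set_pmf p. X \<omega> \<le> k} = ?P"
    by (intro measure_pmf.finite_measure_eq_AE) (auto simp: AE_measure_pmf_iff)
  finally have "\<gamma> / 2 \<le> ?P * (4 / \<gamma> - 1 + \<gamma> / 2)"
    using H Gibbs[OF fin, of w X] wpos sum_w by (smt (verit, best))
  also have "\<dots> \<le> ?P * (4 / \<gamma>)" using \<gamma> by (intro mult_left_mono) auto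
  finally show ?thesis using \<gamma> by (simp add: field_simps power2_eq_square)
qed

lemma total_prob_pmf:
  assumes fin: "finite (set_pmf p)"
  shows "(\<Sum>a\<in>g ` set_pmf p. measure_pmf.prob p {\<omega>. g \<omega> = a} * measure_pmf.prob (cond_pmf p {\<omega>. g \<omega> = a}) A) =
    measure_pmf.prob p A"
proof -
  have "(\<Sum>a\<in>g ` set_pmf p. measure_pmf.prob p {\<omega>. g \<omega> = a} * measure_pmf.prob (cond_pmf p {\<omega>. g \<omega> = a}) A) =
     (\<Sum>a\<in>g ` set_pmf p. measure_pmf.prob p (A \<inter> {\<omega>. g \<omega> = a}))"
  proof (rule sum.cong[OF refl])
    fix a assume "a \<in> g ` set_pmf p"
    then have "set_pmf p \<inter> {\<omega>. g \<omega> = a} \<noteq> {}" "measure_pmf.prob p {\<omega>. g \<omega> = a} > 0"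
      by (auto simp: prob_fibre_pos)
    then show "measure_pmf.prob p {\<omega>. g \<omega> = a} * measure_pmf.prob (cond_pmf p {\<omega>. g \<omega> = a}) A =
      measure_pmf.prob p (A \<inter> {\<omega>. g \<omega> = a})" by (simp add: measure_cond_pmf)
  qed
  also have "\<dots> = measure_pmf.prob p (\<Union>a\<in>g ` set_pmf p. A \<inter> {\<omega>. g \<omega> = a})"
    using fin by (intro measure_pmf.finite_measure_finite_Union[symmetric]) (auto simp: disjoint_family_on_def)
  also have "\<dots> = measure_pmf.prob p A"
    by (intro measure_pmf.finite_measure_eq_AE) (auto simp: AE_measure_pmf_iff)
  finally show ?thesis .
qed

section \<open>Relabelling of vertices by transpositions\<close>

abbreviation transposition :: "nat \<Rightarrow> nat \<Rightarrow> nat \<Rightarrow> nat" where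
  "transposition \<equiv> Transposition.transpose"

lemma restrict_eq_iff: "restrict x A = restrict y A \<longleftrightarrow> (\<forall>e\<in>A. x e = y e)"
  by (auto simp: fun_eq_iff restrict_def)

lemma transposition_pairs_iff:
  assumes "a \<in> {1..n}" "b \<in> {1..n}"
  shows "transposition a b ` e \<in> pairs n \<longleftrightarrow> e \<in> pairs n"
proof -
  have "transposition a b ` e \<subseteq> {1..n} \<longleftrightarrow> e \<subseteq> {1..n}"
    using assms by (auto simp: image_subset_iff Transposition.transpose_def subset_iff split: if_splits)
  moreover have "card (transposition a b ` e) = card e" by (simp add: card_image)
  ultimately show ?thesis by (simp add: pairs_def)
qed

text \<open>Transpositions suffice, since two of them carry any pair to any other, and as
  involutions they spare inverse permutations.\<close>

definition relabel :: "nat \<Rightarrow> nat \<Rightarrow> nat \<Rightarrow> (nat set \<Rightarrow> 'a) \<Rightarrow> nat set \<Rightarrow> 'a" where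
  "relabel n a b x = (\<lambda>e\<in>pairs n. x (transposition a b ` e))"

lemma transposition_image_image: "transposition a b ` transposition a b ` e = e"
  by (simp add: image_image)

text \<open>Collects what the entropy argument uses of the rounded random metric.
  \<open>spread\<close> is the trace of the volume bound: a grid cell has volume
  \<open>1 / real R ^ card (pairs n)\<close> and the polytope has volume at least 1.\<close>

locale exchangeable_metric =
  fixes n R :: nat and p :: "(nat set \<Rightarrow> nat) pmf"
  assumes R: "R \<ge> 1"
    and support: "set_pmf p \<subseteq> pairs n \<rightarrow>\<^sub>E {1..2 * R}"
    and triangle: "\<And>x i j k. x \<in> set_pmf p \<Longrightarrow> i \<in> {1..n} \<Longrightarrow> j \<in> {1..n} \<Longrightarrow> k \<in> {1..n} \<Longrightarrow>
        i \<noteq> j \<Longrightarrow> i \<noteq> k \<Longrightarrow> j \<noteq> k \<Longrightarrow> x {i, j} \<le> x {i, k} + x {k, j}"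
    and exchangeable: "\<And>a b. a \<in> {1..n} \<Longrightarrow> b \<in> {1..n} \<Longrightarrow>
        map_pmf (relabel n a b) p = p"
    and spread: "\<And>x. pmf p x \<le> 1 / real R ^ card (pairs n)"
begin

section \<open>Joint and conditional entropies of the entries\<close>

lemma finite_support: "finite (set_pmf p)"
  using support by (rule finite_subset) (intro finite_PiE, auto)

lemma range_edge: "e \<in> pairs n \<Longrightarrow> (\<lambda>x. x e) ` set_pmf p \<subseteq> {1..2 * R}"
  using support by fastforce

definition ent :: "nat set set \<Rightarrow> real" where
  "ent E = entropy_of p (\<lambda>x. restrict x E)"

text \<open>By the chain rule, the conditional entropy of the entry \<open>e\<close> given the
  entries in \<open>E\<close>.\<close>

definition cent :: "nat set \<Rightarrow> nat set set \<Rightarrow> real" where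
  "cent e E = ent (insert e E) - ent E"

lemma ent_insert: "ent (insert e E) = entropy_of p (\<lambda>x. (x e, restrict x E))"
  unfolding ent_def by (intro entropy_of_cong) (auto simp: restrict_eq_iff)

lemma cent_nonneg: "cent e E \<ge> 0"
  unfolding cent_def ent_insert using entropy_of_pair_ge[OF finite_support] by (simp add: ent_def)

text \<open>Conditioning on more lowers entropy: in the submodular inequality given
  \<open>restrict x A\<close>, the pair of restrictions to \<open>B\<close> and \<open>A\<close>
  carries the same information as \<open>restrict x B\<close>.\<close>

lemma cent_antimono:
  assumes "A \<subseteq> B"
  shows "cent e B \<le> cent e A"
proof -
  have "entropy_of p (\<lambda>x. ((x e, restrict x B), restrict x A)) = ent (insert e B)"
    "entropy_of p (\<lambda>x. (restrict x B, restrict x A)) = ent B"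
    unfolding ent_def using assms by (intro entropy_of_cong; auto simp: restrict_eq_iff)+
  then show ?thesis
    using entropy_of_submodular[OF finite_support, of "\<lambda>x. x e" "\<lambda>x. restrict x B" "\<lambda>x. restrict x A"]
    by (simp add: cent_def ent_insert[of e A]) (simp add: ent_def)
qed

lemma ent_Un_le: "finite B \<Longrightarrow> ent (A \<union> B) \<le> ent A + (\<Sum>e\<in>B. cent e A)"
proof (induction B rule: finite_induct)
  case (insert e B)
  have "ent (A \<union> insert e B) = ent (A \<union> B) + cent e (A \<union> B)"
    by (simp add: cent_def)
  also have "cent e (A \<union> B) \<le> cent e A" by (intro cent_antimono) auto
  finally show ?case using insert by simp
qed simp

lemma ent_empty: "ent {} = 0"
  by (simp add: ent_def entropy_of_def restrict_def)

lemma ent_singleton: "ent {e} = entropy_of p (\<lambda>x. x e)"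
  unfolding ent_def by (intro entropy_of_cong) (auto simp: restrict_eq_iff)

lemma ent_singleton_le: "e \<in> pairs n \<Longrightarrow> ent {e} \<le> ln (2 * R)"
  unfolding ent_singleton using entropy_of_le_ln_card[OF _ finite_support range_edge] by fastforce

lemma ent_le_card: "A \<subseteq> pairs n \<Longrightarrow> ent A \<le> card A * ln (2 * R)"
proof -
  assume A: "A \<subseteq> pairs n"
  then have "finite A" by (rule finite_subset) simp
  then have "ent A \<le> (\<Sum>e\<in>A. cent e {})"
    using ent_Un_le[of A "{}"] by (simp add: ent_empty)
  also have "\<dots> \<le> (\<Sum>e\<in>A. ln (2 * R))"
    using A ent_singleton_le by (intro sum_mono) (auto simp: cent_def ent_empty)
  finally show ?thesis by simp
qed

lemma ent_pairs_ge: "ent (pairs n) \<ge> card (pairs n) * ln R"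
proof -
  have "inj_on (\<lambda>x. restrict x (pairs n)) (set_pmf p)"
    using support by (metis (no_types, lifting) PiE_restrict inj_onI subsetD)
  from entropy_of_ge[OF finite_support this spread]
  have "ent (pairs n) \<ge> - ln (1 / real R ^ card (pairs n))" by (simp add: ent_def)
  also have "- ln (1 / real R ^ card (pairs n)) = card (pairs n) * ln R"
    using R by (simp add: ln_div ln_realpow)
  finally show ?thesis .
qed

lemma ent_transpose:
  assumes ab: "a \<in> {1..n}" "b \<in> {1..n}" and A: "A \<subseteq> pairs n"
  shows "ent ((`) (transposition a b) ` A) = ent A"
proof -
  let ?\<sigma> = "relabel n a b :: (nat set \<Rightarrow> nat) \<Rightarrow> _"
  have "inj_on ?\<sigma> (set_pmf p)"
  proof (rule inj_onI)
    fix x y assume xy: "x \<in> set_pmf p" "y \<in> set_pmf p" "?\<sigma> x = ?\<sigma> y"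
    then have "x \<in> extensional (pairs n)" "y \<in> extensional (pairs n)" using support by (auto simp: PiE_def)
    then show "x = y"
    proof (rule extensionalityI)
      fix e assume "e \<in> pairs n"
      then have "transposition a b ` e \<in> pairs n" using ab by (simp add: transposition_pairs_iff)
      then show "x e = y e" using fun_cong[OF xy(3), of "transposition a b ` e"] by (simp add: relabel_def transposition_image_image)
    qed
  qed
  then have "ent A = entropy_of p ((\<lambda>x. restrict x A) \<circ> ?\<sigma>)"
    using entropy_of_map[of ?\<sigma> p "\<lambda>x. restrict x A"] exchangeable[OF ab] by (simp add: ent_def)
  also have "\<dots> = ent ((`) (transposition a b) ` A)"
    unfolding ent_def using A by (intro entropy_of_cong) (auto simp: restrict_eq_iff subset_iff relabel_def)
  finally show ?thesis ..
qed

text \<open>As a condition this reveals every distance to \<open>S\<close>. It is invariant under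
  the permutations that preserve \<open>S\<close>, so the remaining pairs stay exchangeable.\<close>

definition touching :: "nat set \<Rightarrow> nat set set" where
  "touching S = {e \<in> pairs n. e \<inter> S \<noteq> {}}"

lemma touching_subset: "touching S \<subseteq> pairs n" and touching_mono: "S \<subseteq> S' \<Longrightarrow> touching S \<subseteq> touching S'"
  by (auto simp: touching_def)

lemma touching_transpose:
  assumes "a \<in> {1..n}" "b \<in> {1..n}"
  shows "(`) (transposition a b) ` touching S = touching (transposition a b ` S)"
proof -
  have sub: "(`) (transposition a b) ` touching S \<subseteq> touching (transposition a b ` S)" for S
    using assms by (auto simp: touching_def transposition_pairs_iff)
  show ?thesis
  proof (rule antisym[OF sub])
    have "touching (transposition a b ` S) = (`) (transposition a b) ` (`) (transposition a b) ` touching (transposition a b ` S)"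
      by (simp add: image_comp comp_def transposition_image_image)
    also have "\<dots> \<subseteq> (`) (transposition a b) ` touching (transposition a b ` transposition a b ` S)"
      using sub[of "transposition a b ` S"] by (rule image_mono)
    finally show "touching (transposition a b ` S) \<subseteq> (`) (transposition a b) ` touching S"
      by (simp only: transposition_image_image)
  qed
qed

lemma cent_transpose:
  assumes "a \<in> {1..n}" "b \<in> {1..n}" "e \<in> pairs n"
  shows "cent (transposition a b ` e) (touching (transposition a b ` S)) = cent e (touching S)"
  using ent_transpose[OF assms(1,2), of "insert e (touching S)"] ent_transpose[OF assms(1,2), of "touching S"]
    touching_subset[of S] assms(3)
  by (simp add: cent_def touching_transpose[OF assms(1,2)])

lemma cent_edge:
  assumes S: "S \<subseteq> {1..n}" "1 \<in> {1..n} - S" "2 \<in> {1..n} - S" and ij: "i \<in> {1..n} - S" "j \<in> {1..n} - S" "i \<noteq> j"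
  shows "cent {i, j} (touching S) = cent {1, 2} (touching S)"
proof -
  have fixS: "transposition a b ` S = S" if "a \<notin> S" "b \<notin> S" for a b
    using that by (auto simp: Transposition.transpose_def image_iff split: if_splits)
  \<comment> \<open>The first transposition takes 1 to \<open>i\<close> and 2 to \<open>k\<close>;
    the second takes \<open>k\<close> to \<open>j\<close> and fixes \<open>i\<close>. Both preserve
    \<open>S\<close>, since they move only vertices outside it.\<close>
  define k where "k = transposition 1 i (2 :: nat)"
  have k: "k \<in> {1..n} - S" "k \<noteq> i" using assms by (auto simp: k_def Transposition.transpose_def)
  have "cent {1, 2} (touching S) = cent {i, k} (touching S)"
    using cent_transpose[of 1 i "{1, 2}" S] assms fixS[of 1 i] pair_in_pairs[of 1 n 2] by (simp add: k_def)
  also have "\<dots> = cent {i, j} (touching S)"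
    using cent_transpose[of k j "{i, k}" S] k assms fixS[of k j] pair_in_pairs[of i n k] by simp
  finally show ?thesis ..
qed

text \<open>The conditioning set avoids vertices 1, 2, 3, since the triangle bound is applied to that triangle.\<close>

definition edge_ent :: "nat \<Rightarrow> real" where
  "edge_ent m = cent {1, 2} (touching {4..m + 3})"

text \<open>Vertex 3 acts as the next conditioning vertex \<open>m + 4\<close>. This ties the
  triangle 1, 2, 3 to the next term of the sequence.\<close>

lemma edge_ent_insert3:
  assumes "m + 4 \<le> n"
  shows "cent {1, 2} (touching (insert 3 {4..m + 3})) = edge_ent (Suc m)"
proof -
  have "transposition 3 (m + 4) ` insert 3 {4..m + 3} = insert (m + 4) {4..m + 3}"
    by (auto simp: Transposition.transpose_def image_iff)
  moreover have "\<dots> = {4..Suc m + 3}" by auto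
  moreover have "transposition 3 (m + 4) ` {1, 2} = {1, 2}" by (auto simp: Transposition.transpose_def)
  ultimately show ?thesis
    using cent_transpose[of 3 "m + 4" "{1, 2}" "insert 3 {4..m + 3}"] assms pair_in_pairs[of 1 n 2]
    by (simp add: edge_ent_def)
qed

lemma edge_ent_insert2:
  assumes "m + 4 \<le> n"
  shows "cent {1, 3} (touching (insert 2 {4..m + 3})) = edge_ent (Suc m)"
proof -
  have "transposition 2 3 ` insert 3 {4..m + 3} = insert 2 {4..m + 3}"
    by (auto simp: Transposition.transpose_def image_iff)
  moreover have "transposition 2 3 ` {1, 2} = {1, 3 :: nat}" by (auto simp: Transposition.transpose_def)
  ultimately show ?thesis
    using cent_transpose[of 2 3 "{1, 2}" "insert 3 {4..m + 3}"] assms pair_in_pairs[of 1 n 2]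
    unfolding edge_ent_insert3[OF assms, symmetric] by simp
qed

text \<open>Chain rule with the sides in the order \<open>{2, 3}\<close>, \<open>{1, 3}\<close>,
  \<open>{1, 2}\<close>. What is known before the second side is part of all distances to vertex 2
  and the old vertices, and before the third part of those to vertex 3 and the old vertices;
  revealing the whole of them leaves \<open>edge_ent (Suc m)\<close>.\<close>

lemma ent_triangle_ge:
  assumes "m + 4 \<le> n"
  shows "ent (insert {1, 2} (insert {1, 3} (insert {2, 3} (touching {4..m + 3})))) - ent (touching {4..m + 3})
    \<ge> edge_ent m + 2 * edge_ent (Suc m)"
proof -
  let ?T = "touching {4..m + 3}"
  have p: "{2, 3} \<in> pairs n" "{1, 3} \<in> pairs n"
    using assms by (auto intro!: pair_in_pairs)
  have "cent {2, 3} ?T = edge_ent m"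
    unfolding edge_ent_def using assms by (intro cent_edge) auto
  moreover have "cent {1, 3} (insert {2, 3} ?T) \<ge> edge_ent (Suc m)"
    unfolding edge_ent_insert2[OF assms, symmetric] using p touching_mono[of "{4..m + 3}" "insert 2 {4..m + 3}"]
    by (intro cent_antimono) (auto simp: touching_def)
  moreover have "cent {1, 2} (insert {1, 3} (insert {2, 3} ?T)) \<ge> edge_ent (Suc m)"
    unfolding edge_ent_insert3[OF assms, symmetric] using p touching_mono[of "{4..m + 3}" "insert 3 {4..m + 3}"]
    by (intro cent_antimono) (auto simp: touching_def)
  ultimately show ?thesis unfolding cent_def by linarith
qed

text \<open>The triangle bound is applied to each conditional law given the distances to
  \<open>{4..m + 3}\<close> and averaged. By \<open>ent_triangle_ge\<close> the averaged total
  correlation of the sides is at most twice the drop of \<open>edge_ent\<close>, whence the factor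
  8.\<close>

lemma short_edge_step:
  fixes \<beta> \<eta> :: real
  assumes m: "m + 4 \<le> n" and \<beta>: "0 < \<beta>" "\<beta> \<le> 1 / 4" and \<eta>: "0 \<le> \<eta>" "\<eta> \<le> 1"
  shows "3 * edge_ent m + \<eta> * measure_pmf.prob p {x. x {1, 2} < (1 - \<eta>) * R}
    \<le> 3 * ln R + (3 / R + 7 * \<beta> + 6 * \<beta> * ln (2 * R / \<beta>)) + 8 / \<beta> ^ 3 * (edge_ent m - edge_ent (Suc m))"
proof -
  let ?T = "touching {4..m + 3}"
  define g where "g x = restrict x ?T" for x :: "nat set \<Rightarrow> nat"
  let ?G = "g ` set_pmf p" and ?P = "\<lambda>a. measure_pmf.prob p {x. g x = a}" and ?c = "\<lambda>a. cond_pmf p {x. g x = a}"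
  let ?X = "\<lambda>x :: nat set \<Rightarrow> nat. x {1, 2}" and ?Y = "\<lambda>x :: nat set \<Rightarrow> nat. x {1, 3}" and ?Z = "\<lambda>x :: nat set \<Rightarrow> nat. x {2, 3}"
  let ?W = "\<lambda>x. (?X x, ?Y x, ?Z x)"
  define avg where "avg F = (\<Sum>a\<in>?G. ?P a * F (?c a))" for F :: "(nat set \<Rightarrow> nat) pmf \<Rightarrow> real"
  let ?A = "{x. ?X x < (1 - \<eta>) * R}"
  let ?err = "3 / R + 7 * \<beta> + 6 * \<beta> * ln (2 * R / \<beta>)"
  have pr: "{1, 2} \<in> pairs n" "{1, 3} \<in> pairs n" "{2, 3} \<in> pairs n"
    using m by (auto intro!: pair_in_pairs)
  have step: "entropy_of q ?X + entropy_of q ?Y + entropy_of q ?Z + \<eta> * measure_pmf.prob q ?A \<le> 3 * ln R + ?err +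
      4 / \<beta> ^ 3 * (entropy_of q ?X + entropy_of q ?Y + entropy_of q ?Z - entropy_of q ?W)"
    if q: "set_pmf q \<subseteq> set_pmf p" for q
  proof (rule triangle_entropy_bound)
    show "finite (set_pmf q)" using q finite_support by (rule finite_subset)
    show "?X ` set_pmf q \<subseteq> {1..2 * R}" "?Y ` set_pmf q \<subseteq> {1..2 * R}" "?Z ` set_pmf q \<subseteq> {1..2 * R}"
      using range_edge[OF pr(1)] range_edge[OF pr(2)] range_edge[OF pr(3)] q by blast+
    show "?X x \<le> ?Y x + ?Z x" "?Y x \<le> ?X x + ?Z x" "?Z x \<le> ?X x + ?Y x" if "x \<in> set_pmf q" for x
      using triangle[of x 1 2 3] triangle[of x 1 3 2] triangle[of x 2 3 1] that q m
      by (auto simp: insert_commute)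
  qed (use R \<beta> \<eta> in simp_all)
  have mono: "avg (\<lambda>q. entropy_of q ?X + entropy_of q ?Y + entropy_of q ?Z + \<eta> * measure_pmf.prob q ?A) \<le>
      avg (\<lambda>q. 3 * ln R + ?err + 4 / \<beta> ^ 3 * (entropy_of q ?X + entropy_of q ?Y + entropy_of q ?Z - entropy_of q ?W))"
    unfolding avg_def
  proof (intro sum_mono mult_left_mono step)
    fix a assume "a \<in> ?G"
    then have "set_pmf p \<inter> {x. g x = a} \<noteq> {}" by auto
    then show "set_pmf (?c a) \<subseteq> set_pmf p" by (simp add: set_cond_pmf)
  qed auto
  have linear: "avg (\<lambda>q. F q + F' q) = avg F + avg F'" "avg (\<lambda>q. F q - F' q) = avg F - avg F'" "avg (\<lambda>q. r * F q) = r * avg F"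
    for F F' r
    by (simp_all add: avg_def distrib_left right_diff_distrib sum.distrib sum_subtractf sum_distrib_left mult_ac)
  have const: "avg (\<lambda>_. r) = r" for r
    unfolding avg_def by (simp only: sum_distrib_right[symmetric] sum_prob_fibres[OF finite_support] mult_1)
  have prob: "avg (\<lambda>q. measure_pmf.prob q ?A) = measure_pmf.prob p ?A"
    unfolding avg_def by (rule total_prob_pmf[OF finite_support])
  have edge: "avg (\<lambda>q. entropy_of q (\<lambda>x. x e)) = cent e ?T" for e
    unfolding avg_def entropy_of_chain[OF finite_support, symmetric]
    by (simp add: cent_def ent_insert) (simp add: ent_def g_def)
  have tri: "avg (\<lambda>q. entropy_of q ?W) = ent (insert {1, 2} (insert {1, 3} (insert {2, 3} ?T))) - ent ?T"
    unfolding avg_def entropy_of_chain[OF finite_support, symmetric]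
    by (auto simp: ent_def g_def restrict_eq_iff intro!: entropy_of_cong)
  have edge_ent: "cent {1, 2} ?T = edge_ent m" "cent {1, 3} ?T = edge_ent m" "cent {2, 3} ?T = edge_ent m"
    unfolding edge_ent_def by (rule refl, (rule cent_edge; use m in auto)+)
  have "edge_ent m + edge_ent m + edge_ent m + \<eta> * measure_pmf.prob p ?A \<le> 3 * ln R + ?err + 4 / \<beta> ^ 3 *
     (edge_ent m + edge_ent m + edge_ent m - (ent (insert {1, 2} (insert {1, 3} (insert {2, 3} ?T))) - ent ?T))"
    using mono unfolding linear const prob edge tri edge_ent .
  also have "\<dots> \<le> 3 * ln R + ?err + 4 / \<beta> ^ 3 * (2 * (edge_ent m - edge_ent (Suc m)))"
    using ent_triangle_ge[OF m] \<beta> by (intro add_left_mono mult_left_mono) auto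
  finally show ?thesis by simp
qed

section \<open>Quantitative bounds on the conditional entropies\<close>

lemma card_touching_le: "card (touching S) \<le> card S * n" if "finite S"
proof -
  have "touching S \<subseteq> (\<lambda>(s, j). {s, j}) ` (S \<times> {1..n})"
  proof
    fix e assume "e \<in> touching S"
    then obtain s where s: "s \<in> e" "s \<in> S" "card e = 2" "e \<subseteq> {1..n}" by (auto simp: touching_def pairs_def)
    then obtain j where "e = {s, j}" by (auto simp: card_2_iff)
    with s show "e \<in> (\<lambda>(s, j). {s, j}) ` (S \<times> {1..n})" by auto
  qed
  then have "card (touching S) \<le> card (S \<times> {1..n})"
    using that by (intro surj_card_le) auto
  then show ?thesis by (simp add: card_cartesian_product)
qed

lemma card_pairs: "2 * card (pairs n) = n * (n - 1)"
proof -
  have "even (n * (n - 1))" by (cases n) auto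
  then show ?thesis using n_subsets[of "{1..n}" 2] by (simp add: pairs_def choose_two)
qed

text \<open>Of the total entropy \<open>card (pairs n) * ln R\<close>, the entries in the condition
  account for at most \<open>m * n * ln (2 * R)\<close>. All other entries have the same conditional
  entropy by exchangeability, so dividing by \<open>n * (n - 1) / 2\<close> gives the bound.\<close>

lemma edge_ent_ge:
  assumes n: "m + 3 \<le> n"
  shows "edge_ent m \<ge> ln R - 2 * real m / (real n - 1) * ln (2 * R)"
proof -
  let ?T = "touching {4..m + 3}" and ?N = "real (card (pairs n))"
  have N: "2 * ?N = real n * (real n - 1)"
    using arg_cong[OF card_pairs, of real] n by (simp add: of_nat_diff)
  have "real n * (real n - 1) > 0" using n by (intro mult_pos_pos) auto
  then have Npos: "?N > 0" using N by linarith
  have lnR: "ln (real (2 * R)) \<ge> 0" using R by simp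
  have "cent e ?T = edge_ent m" if "e \<in> pairs n - ?T" for e
  proof -
    have "card e = 2" using that by (auto simp: pairs_def)
    then obtain i j where e: "e = {i, j}" "i \<noteq> j" by (auto simp: card_2_iff)
    then have "i \<in> {1..n} - {4..m + 3}" "j \<in> {1..n} - {4..m + 3}"
      using that by (auto simp: touching_def pairs_def)
    then show ?thesis unfolding e edge_ent_def using n e by (intro cent_edge) auto
  qed
  then have "(\<Sum>e\<in>pairs n - ?T. cent e ?T) \<le> (\<Sum>e\<in>pairs n - ?T. edge_ent m)"
    by (intro sum_mono) simp
  also have "\<dots> \<le> (\<Sum>e\<in>pairs n. edge_ent m)"
    by (intro sum_mono2) (auto simp: edge_ent_def cent_nonneg)
  finally have "(\<Sum>e\<in>pairs n - ?T. cent e ?T) \<le> ?N * edge_ent m" by simp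
  moreover have "ent (pairs n) \<le> ent ?T + (\<Sum>e\<in>pairs n - ?T. cent e ?T)"
    using ent_Un_le[of "pairs n - ?T" ?T] touching_subset[of "{4..m + 3}"] by (simp add: Un_absorb1)
  moreover have "ent ?T \<le> real m * n * ln (real (2 * R))"
  proof -
    have "ent ?T \<le> real (card ?T) * ln (real (2 * R))" by (rule ent_le_card[OF touching_subset])
    also have "real (card ?T) \<le> real m * n" using of_nat_mono[OF card_touching_le[of "{4..m + 3}"], where 'a = real] by simp
    finally show ?thesis using lnR by (simp add: mult_right_mono)
  qed
  ultimately have "?N * ln R \<le> real m * n * ln (real (2 * R)) + ?N * edge_ent m"
    using ent_pairs_ge by linarith
  also have "real m * n * ln (real (2 * R)) = ?N * (2 * real m / (real n - 1) * ln (real (2 * R)))"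
  proof -
    have "real n - 1 \<noteq> 0" using n by simp
    have "?N * (2 * real m / (real n - 1)) = (2 * ?N) * (m / (real n - 1))" by simp
    also have "\<dots> = real m * n" unfolding N using \<open>real n - 1 \<noteq> 0\<close> by simp
    finally have "?N * (2 * real m / (real n - 1)) = real m * n" .
    then show ?thesis by (metis mult.assoc)
  qed
  finally have "?N * ln R \<le> ?N * (2 * real m / (real n - 1) * ln (real (2 * R)) + edge_ent m)"
    by (simp only: distrib_left)
  then show ?thesis using Npos by (simp del: of_nat_mult)
qed

lemma edge_ent_0: "edge_ent 0 = entropy_of p (\<lambda>x. x {1, 2})"
  by (simp add: edge_ent_def touching_def cent_def ent_empty ent_singleton)

text \<open>Pigeonhole on \<open>m < M\<close>: the drops of \<open>edge_ent\<close> telescope to at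
  most \<open>ln (2 * R)\<close>, so one is at most \<open>ln (2 * R) / M\<close>. A larger
  \<open>M\<close> makes this drop smaller but the loss in \<open>edge_ent_ge\<close> larger, which
  explains the two terms with \<open>M\<close>.\<close>

lemma short_edge_prob:
  fixes \<beta> \<eta> :: real
  assumes M: "1 \<le> M" "M + 3 \<le> n" and \<beta>: "0 < \<beta>" "\<beta> \<le> 1 / 4" and \<eta>: "0 \<le> \<eta>" "\<eta> \<le> 1"
  shows "\<eta> * measure_pmf.prob p {x. x {1, 2} < (1 - \<eta>) * R} \<le>
    6 * real M / (real n - 1) * ln (2 * R) + (3 / R + 7 * \<beta> + 6 * \<beta> * ln (2 * R / \<beta>)) + 8 * ln (2 * R) / (M * \<beta> ^ 3)"
proof -
  have "\<exists>m<M. edge_ent m - edge_ent (Suc m) \<le> ln (2 * R) / M"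
  proof (rule ccontr)
    assume "\<not> ?thesis"
    then have "(\<Sum>m<M. ln (2 * R) / M) < (\<Sum>m<M. edge_ent m - edge_ent (Suc m))"
      using M by (intro sum_strict_mono) (auto simp: not_le lessThan_empty_iff)
    also have "\<dots> = edge_ent 0 - edge_ent M" by (rule sum_lessThan_telescope')
    also have "\<dots> \<le> edge_ent 0" by (simp add: edge_ent_def cent_nonneg)
    also have "\<dots> \<le> ln (2 * R)"
      using ent_singleton_le[of "{1, 2}"] M pair_in_pairs[of 1 n 2] by (simp add: edge_ent_0 ent_singleton)
    finally show False using M by simp
  qed
  then obtain m where m: "m < M" "edge_ent m - edge_ent (Suc m) \<le> ln (2 * R) / M" by blast
  have lnR: "ln (2 * R) \<ge> 0" using R by simp
  have "8 / \<beta> ^ 3 * (edge_ent m - edge_ent (Suc m)) \<le> 8 / \<beta> ^ 3 * (ln (2 * R) / M)"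
    using m \<beta> by (intro mult_left_mono) auto
  also have "\<dots> = 8 * ln (2 * R) / (M * \<beta> ^ 3)" by simp
  finally have 1: "8 / \<beta> ^ 3 * (edge_ent m - edge_ent (Suc m)) \<le> 8 * ln (2 * R) / (M * \<beta> ^ 3)" .
  have "2 * real m / (real n - 1) * ln (2 * R) \<le> 2 * real M / (real n - 1) * ln (2 * R)"
    using m M lnR by (intro mult_right_mono divide_right_mono) auto
  moreover have "edge_ent m \<ge> ln R - 2 * real m / (real n - 1) * ln (2 * R)"
    using m M by (intro edge_ent_ge) auto
  moreover have "6 * real M / (real n - 1) * ln (2 * R) = 3 * (2 * real M / (real n - 1) * ln (2 * R))" by simp
  ultimately have 2: "3 * ln R - 3 * edge_ent m \<le> 6 * real M / (real n - 1) * ln (2 * R)" by linarith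
  show ?thesis using short_edge_step[of m \<beta> \<eta>] m M \<beta> \<eta> 1 2 by linarith
qed

lemma edge_lower_mass:
  fixes \<gamma> :: real
  assumes "n \<ge> 3" "0 < \<gamma>" "\<gamma> \<le> 1" "(1 + \<gamma>) * R \<le> k" "k < 2 * R"
  shows "measure_pmf.prob p {x. x {1, 2} \<le> k} \<ge> \<gamma>\<^sup>2 / 8"
proof (rule entropy_lower_mass[OF finite_support range_edge])
  show "ln R \<le> entropy_of p (\<lambda>x. x {1, 2})"
    using edge_ent_ge[of 0] assms by (simp add: edge_ent_0)
qed (use assms pair_in_pairs[of 1 n 2] in auto)

end

section \<open>The uniform measure on the metric polytope\<close>

lemma metric_polytope_subset_space: "metric_polytope n \<subseteq> space (lebesgue_pairs n)"
  by (auto simp: metric_polytope_def space_lebesgue_pairs)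

text \<open>Entries in \<open>[1, 2]\<close> satisfy every triangle inequality, and the arrays with
  such entries form a unit cube.\<close>

lemma measure_metric_polytope_ge_1: "measure (lebesgue_pairs n) (metric_polytope n) \<ge> 1"
proof -
  have "Pi\<^sub>E (pairs n) (\<lambda>_. {1..2}) \<subseteq> metric_polytope n"
  proof
    fix d :: "nat set \<Rightarrow> real" assume d: "d \<in> Pi\<^sub>E (pairs n) (\<lambda>_. {1..2})"
    then have *: "1 \<le> d e \<and> d e \<le> 2" if "e \<in> pairs n" for e
      using that by auto
    have "d {i, j} \<le> d {i, k} + d {k, j}"
      if "i \<in> {1..n}" "j \<in> {1..n}" "k \<in> {1..n}" "i \<noteq> j" "i \<noteq> k" "j \<noteq> k" for i j k
      using *[OF pair_in_pairs[of i n j]] *[OF pair_in_pairs[of i n k]] *[OF pair_in_pairs[of k n j]] that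
      by force
    with * d show "d \<in> metric_polytope n"
      unfolding metric_polytope_def by (fastforce simp: PiE_def)
  qed
  from emeasure_mono[OF this metric_polytope_sets] emeasure_box[of 1 2 n]
  have "1 \<le> emeasure (lebesgue_pairs n) (metric_polytope n)" by simp
  moreover have "emeasure (lebesgue_pairs n) (metric_polytope n) = ennreal (measure (lebesgue_pairs n) (metric_polytope n))"
    using emeasure_metric_polytope(2)[of n] by (intro emeasure_eq_ennreal_measure) auto
  ultimately show ?thesis by simp
qed

lemma measure_uniform_metric:
  assumes "A \<in> sets (lebesgue_pairs n)"
  shows "measure (uniform_metric n) A =
    measure (lebesgue_pairs n) (metric_polytope n \<inter> A) / measure (lebesgue_pairs n) (metric_polytope n)"
  unfolding uniform_metric_def using assms emeasure_metric_polytope[of n] 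
  by (subst measure_uniform_measure) auto

lemma sets_uniform_metric: "sets (uniform_metric n) = sets (lebesgue_pairs n)"
  and space_uniform_metric: "space (uniform_metric n) = space (lebesgue_pairs n)"
  by (simp_all add: uniform_metric_def)

lemma entry_le_sets:
  "e \<in> pairs n \<Longrightarrow> {d \<in> space (lebesgue_pairs n). d e \<le> t} \<in> sets (lebesgue_pairs n)"
  by (intro borel_measurable_le measurable_entry) auto

lemma metric_polytope_midpoint:
  assumes "x \<in> metric_polytope n" "y \<in> metric_polytope n"
  shows "(\<lambda>e\<in>pairs n. (x e + y e) / 2) \<in> metric_polytope n"
proof -
  have x: "0 < x e \<and> x e \<le> 2" and y: "0 < y e \<and> y e \<le> 2" if "e \<in> pairs n" for e
    using assms that by (auto simp: metric_polytope_def)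
  have "(x {i, j} + y {i, j}) / 2 \<le> (x {i, k} + y {i, k}) / 2 + (x {k, j} + y {k, j}) / 2"
    if "i \<in> {1..n}" "j \<in> {1..n}" "k \<in> {1..n}" "i \<noteq> j" "i \<noteq> k" "j \<noteq> k" for i j k
  proof -
    have "x {i, j} \<le> x {i, k} + x {k, j}" "y {i, j} \<le> y {i, k} + y {k, j}"
      using assms that unfolding metric_polytope_def by blast+
    then show ?thesis by (simp add: add_divide_distrib[symmetric] divide_right_mono)
  qed
  moreover have "0 < (x e + y e) / 2 \<and> (x e + y e) / 2 \<le> 2" if "e \<in> pairs n" for e
    using x[OF that] y[OF that] by auto
  ultimately show ?thesis
    unfolding metric_polytope_def by (auto simp: pair_in_pairs)
qed

lemma emeasure_metric_polytope_subset:
  "emeasure (lebesgue_pairs n) (metric_polytope n \<inter> A) = ennreal (measure (lebesgue_pairs n) (metric_polytope n \<inter> A))"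
proof (rule emeasure_eq_ennreal_measure)
  have "emeasure (lebesgue_pairs n) (metric_polytope n \<inter> A) \<le> emeasure (lebesgue_pairs n) (metric_polytope n)"
    by (intro emeasure_mono) auto
  then show "emeasure (lebesgue_pairs n) (metric_polytope n \<inter> A) \<noteq> \<top>"
    using emeasure_metric_polytope(2)[of n] by (auto simp: top_unique)
qed

text \<open>Prekopa-Leindler for indicators: by convexity, midpoints of the slices for
  \<open>s\<close> and \<open>t\<close> lie in the slice for \<open>(s + t) / 2\<close>. The
  midpoint form fits the later use at equally spaced points.\<close>

lemma entry_cdf_log_concave:
  assumes e: "e \<in> pairs n"
  defines "F \<equiv> \<lambda>t. measure (uniform_metric n) {d \<in> space (uniform_metric n). d e \<le> t}"
  shows "F s * F t \<le> (F ((s + t) / 2))\<^sup>2"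
proof -
  let ?L = "lebesgue_pairs n" and ?M = "metric_polytope n"
  define A where "A t = {d \<in> space ?L. d e \<le> t}" for t
  have A[measurable]: "?M \<inter> A t \<in> sets ?L" for t
    using entry_le_sets[OF e] by (auto simp: A_def)
  have "emeasure ?L (?M \<inter> A s) * emeasure ?L (?M \<inter> A t) \<le> (emeasure ?L (?M \<inter> A ((s + t) / 2)))\<^sup>2"
  proof -
    have "integral\<^sup>N ?L (indicator (?M \<inter> A s)) * integral\<^sup>N ?L (indicator (?M \<inter> A t)) \<le>
        (integral\<^sup>N ?L (indicator (?M \<inter> A ((s + t) / 2))))\<^sup>2"
      unfolding lebesgue_pairs_def
    proof (rule Prekopa_Leindler_PiM)
      show "indicator (?M \<inter> A s) x * indicator (?M \<inter> A t) y \<le>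
          (indicator (?M \<inter> A ((s + t) / 2)) (\<lambda>e\<in>pairs n. (x e + y e) / 2) :: ennreal)\<^sup>2" for x y
      proof (cases "x \<in> ?M \<inter> A s \<and> y \<in> ?M \<inter> A t")
        case True
        then have "(\<lambda>e\<in>pairs n. (x e + y e) / 2) \<in> ?M \<inter> A ((s + t) / 2)"
          using metric_polytope_midpoint[of x n y] e by (auto simp: A_def space_lebesgue_pairs)
        then show ?thesis by (auto split: split_indicator)
      qed (auto split: split_indicator)
    qed (use A in \<open>auto simp: lebesgue_pairs_def\<close>)
    then show ?thesis by simp
  qed
  then have "measure ?L (?M \<inter> A s) * measure ?L (?M \<inter> A t) \<le> (measure ?L (?M \<inter> A ((s + t) / 2)))\<^sup>2"
    unfolding emeasure_metric_polytope_subset by (simp add: ennreal_mult[symmetric] ennreal_power)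
  moreover have "F u = measure ?L (?M \<inter> A u) / measure ?L ?M" for u
    unfolding F_def A_def space_uniform_metric by (intro measure_uniform_metric entry_le_sets e)
  ultimately show ?thesis
    by (simp add: power_divide power2_eq_square divide_right_mono)
qed

section \<open>Invariance of the uniform measure under relabelling\<close>

lemma distr_PiM_permute:
  fixes f :: "'i \<Rightarrow> 'i"
  assumes fin: "finite I" and f: "bij_betw f I I"
  shows "distr (Pi\<^sub>M I (\<lambda>_. lborel :: real measure)) (Pi\<^sub>M I (\<lambda>_. lborel)) (\<lambda>x. \<lambda>i\<in>I. x (f i)) = Pi\<^sub>M I (\<lambda>_. lborel)"
proof -
  interpret product_sigma_finite "\<lambda>_ :: 'i. lborel :: real measure" by standard
  let ?P = "Pi\<^sub>M I (\<lambda>_. lborel :: real measure)" and ?\<sigma> = "\<lambda>x :: 'i \<Rightarrow> real. \<lambda>i\<in>I. x (f i)"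
  have fI: "f i \<in> I" if "i \<in> I" for i using f that by (auto simp: bij_betw_def)
  have [measurable]: "?\<sigma> \<in> measurable ?P ?P"
    by (intro measurable_restrict measurable_component_singleton fI)
  show ?thesis
  proof (rule PiM_eqI[OF fin])
    fix A :: "'i \<Rightarrow> real set" assume A: "\<And>i. i \<in> I \<Longrightarrow> A i \<in> sets lborel"
    let ?g = "the_inv_into I f"
    have g: "?g i \<in> I" "f (?g i) = i" "?g (f i) = i" if "i \<in> I" for i
      using f that by (auto simp: bij_betw_def the_inv_into_into f_the_inv_into_f the_inv_into_f_f)
    have "?\<sigma> -` Pi\<^sub>E I A \<inter> space ?P = Pi\<^sub>E I (\<lambda>i. A (?g i))"
    proof (intro equalityI subsetI)
      fix x assume "x \<in> ?\<sigma> -` Pi\<^sub>E I A \<inter> space ?P"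
      then have x: "x \<in> extensional I" "\<And>i. i \<in> I \<Longrightarrow> x (f i) \<in> A i" by (auto simp: space_PiM PiE_def Pi_def)
      then show "x \<in> Pi\<^sub>E I (\<lambda>i. A (?g i))" using g by (auto simp: PiE_def) metis
    next
      fix x assume x: "x \<in> Pi\<^sub>E I (\<lambda>i. A (?g i))"
      then have "x (f i) \<in> A i" if "i \<in> I" for i using PiE_mem[OF x fI[OF that]] g that by simp
      then show "x \<in> ?\<sigma> -` Pi\<^sub>E I A \<inter> space ?P" using x by (auto simp: space_PiM PiE_def)
    qed
    then have "emeasure (distr ?P ?P ?\<sigma>) (Pi\<^sub>E I A) = emeasure ?P (Pi\<^sub>E I (\<lambda>i. A (?g i)))"
      using A fin by (subst emeasure_distr) (auto intro!: sets_PiM_I_finite)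
    also have "\<dots> = (\<Prod>i\<in>I. emeasure lborel (A (?g i)))"
      using A fin g by (intro emeasure_PiM) auto
    also have "\<dots> = (\<Prod>i\<in>I. emeasure lborel (A i))"
      using f by (intro prod.reindex_bij_betw bij_betw_the_inv_into)
    finally show "emeasure (distr ?P ?P ?\<sigma>) (Pi\<^sub>E I A) = (\<Prod>i\<in>I. emeasure lborel (A i))" .
  qed simp
qed

lemma relabel_metric_polytope_iff:
  assumes ab: "a \<in> {1..n}" "b \<in> {1..n}" and d: "d \<in> extensional (pairs n)"
  shows "relabel n a b d \<in> metric_polytope n \<longleftrightarrow> d \<in> metric_polytope n"
proof -
  have imp: "relabel n a b d \<in> metric_polytope n" if d: "d \<in> metric_polytope n" for d
  proof -
    let ?t = "transposition a b"
    have t: "?t i \<in> {1..n}" if "i \<in> {1..n}" for i using ab that by (auto simp: Transposition.transpose_def)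
    have inj: "?t i \<noteq> ?t j" if "i \<noteq> j" for i j using that by (metis transpose_involutory)
    have "d {?t i, ?t j} \<le> d {?t i, ?t k} + d {?t k, ?t j}"
      if "i \<in> {1..n}" "j \<in> {1..n}" "k \<in> {1..n}" "i \<noteq> j" "i \<noteq> k" "j \<noteq> k" for i j k
      using d t that inj unfolding metric_polytope_def by blast
    moreover have "0 < d (?t ` e) \<and> d (?t ` e) \<le> 2" if "e \<in> pairs n" for e
      using d that ab by (auto simp: metric_polytope_def transposition_pairs_iff)
    ultimately show ?thesis
      by (auto simp: metric_polytope_def relabel_def pair_in_pairs)
  qed
  moreover have "relabel n a b (relabel n a b d) = d"
    using d ab by (auto simp: relabel_def fun_eq_iff transposition_pairs_iff image_image extensional_def)
  ultimately show ?thesis by metis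
qed

lemma measure_uniform_metric_relabel:
  assumes ab: "a \<in> {1..n}" "b \<in> {1..n}" and A: "A \<in> sets (lebesgue_pairs n)"
  shows "measure (uniform_metric n) (relabel n a b -` A \<inter> space (lebesgue_pairs n)) = measure (uniform_metric n) A"
proof -
  let ?L = "lebesgue_pairs n" and ?M = "metric_polytope n" and ?\<sigma> = "relabel n a b :: (nat set \<Rightarrow> real) \<Rightarrow> _"
  have bij: "bij_betw ((`) (transposition a b)) (pairs n) (pairs n)"
    using ab by (intro bij_betwI[where g = "(`) (transposition a b)"]) (auto simp: transposition_pairs_iff image_image)
  have meas[measurable]: "?\<sigma> \<in> measurable ?L ?L"
    unfolding lebesgue_pairs_def relabel_def
    using ab by (intro measurable_restrict measurable_component_singleton) (simp add: transposition_pairs_iff)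
  have "distr ?L ?L ?\<sigma> = ?L"
    using distr_PiM_permute[OF finite_pairs bij] by (simp add: lebesgue_pairs_def relabel_def[abs_def])
  then have inv: "measure ?L (?\<sigma> -` B \<inter> space ?L) = measure ?L B" if "B \<in> sets ?L" for B
    using measure_distr[OF meas that] by simp
  have "?M \<inter> (?\<sigma> -` A \<inter> space ?L) = ?\<sigma> -` (?M \<inter> A) \<inter> space ?L"
    using metric_polytope_subset_space[of n] relabel_metric_polytope_iff[OF ab] by (auto simp: space_lebesgue_pairs)
  then show ?thesis
    using inv[of "?M \<inter> A"] A by (simp add: measure_uniform_metric)
qed

lemma entry_cdf_eq:
  assumes e: "e \<in> pairs n"
  shows "measure (uniform_metric n) {d \<in> space (uniform_metric n). d e \<le> t} =
    measure (uniform_metric n) {d \<in> space (uniform_metric n). d {1, 2} \<le> t}"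
proof -
  define F where "F e = measure (uniform_metric n) {d \<in> space (uniform_metric n). d e \<le> t}" for e
  have step: "F (transposition a b ` e) = F e" if "a \<in> {1..n}" "b \<in> {1..n}" "e \<in> pairs n" for a b e
  proof -
    have "relabel n a b -` {d \<in> space (lebesgue_pairs n). d e \<le> t} \<inter> space (lebesgue_pairs n) =
        {d \<in> space (lebesgue_pairs n). d (transposition a b ` e) \<le> t}"
      using that by (auto simp: relabel_def space_lebesgue_pairs)
    then show ?thesis
      using measure_uniform_metric_relabel[OF that(1,2) entry_le_sets[OF that(3), of t]]
      by (simp add: F_def space_uniform_metric)
  qed
  obtain i j where ij: "e = {i, j}" "i \<noteq> j" "i \<in> {1..n}" "j \<in> {1..n}"
    using e by (auto simp: pairs_def card_2_iff)
  \<comment> \<open>The same two transpositions as in \<open>cent_edge\<close>.\<close>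
  define k where "k = transposition 1 i 2"
  have n: "n \<ge> 2" using ij by (cases "n = 1") auto
  have k: "k \<in> {1..n}" "k \<noteq> i" using ij n by (auto simp: k_def Transposition.transpose_def)
  have "F {1, 2} = F {i, k}"
    using step[of 1 i "{1, 2}"] ij n pair_in_pairs[of 1 n 2] by (simp add: k_def)
  also have "\<dots> = F {i, j}"
    using step[of k j "{i, k}"] k ij pair_in_pairs[of i n k] by simp
  finally show ?thesis by (simp add: F_def ij)
qed

text \<open>Rounding up is subadditive, so the rounded distances satisfy the triangle inequality exactly.\<close>

definition discretize :: "nat \<Rightarrow> nat \<Rightarrow> (nat set \<Rightarrow> real) \<Rightarrow> nat set \<Rightarrow> nat" where
  "discretize n R d = (\<lambda>e\<in>pairs n. nat \<lceil>R * d e\<rceil>)"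

lemma measurable_discretize: "discretize n R \<in> measurable (uniform_metric n) (count_space UNIV)"
proof -
  \<comment> \<open>The function type is uncountable, but the values of \<open>discretize\<close>
    are extensional on a finite index set. They form a countable set, on which singletons decide
    measurability.\<close>
  let ?C = "pairs n \<rightarrow>\<^sub>E (UNIV :: nat set)"
  have "discretize n R \<in> measurable (uniform_metric n) (count_space ?C)"
  proof (subst measurable_count_space_eq_countable)
    show "countable ?C" by (intro countable_PiE) auto
    have "discretize n R -` {x} \<inter> space (uniform_metric n) \<in> sets (uniform_metric n)" if "x \<in> ?C" for x
    proof -
      have "discretize n R -` {x} \<inter> space (uniform_metric n) =
          {d \<in> space (lebesgue_pairs n). \<forall>e\<in>pairs n. nat \<lceil>R * d e\<rceil> = x e}"
        using that by (auto simp: discretize_def space_uniform_metric fun_eq_iff PiE_def extensional_def)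
      moreover have "{d \<in> space (lebesgue_pairs n). nat \<lceil>R * d e\<rceil> = x e} \<in> sets (lebesgue_pairs n)" if "e \<in> pairs n" for e
      proof -
        note [measurable] = measurable_entry[OF that]
        show ?thesis by measurable
      qed
      then have "{d \<in> space (lebesgue_pairs n). \<forall>e\<in>pairs n. nat \<lceil>R * d e\<rceil> = x e} \<in> sets (lebesgue_pairs n)"
        by (intro sets.sets_Collect_finite_All finite_pairs)
      ultimately show ?thesis by (simp add: sets_uniform_metric)
    qed
    then show "discretize n R \<in> space (uniform_metric n) \<rightarrow> ?C \<and>
        (\<forall>x\<in>?C. discretize n R -` {x} \<inter> space (uniform_metric n) \<in> sets (uniform_metric n))"
      by (auto simp: discretize_def)
  qed
  moreover have "(\<lambda>x. x) \<in> measurable (count_space ?C) (count_space UNIV)" by simp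
  ultimately show ?thesis by (rule measurable_compose)
qed

definition discrete_law :: "nat \<Rightarrow> nat \<Rightarrow> (nat set \<Rightarrow> nat) pmf" where
  "discrete_law n R = Abs_pmf (distr (uniform_metric n) (count_space UNIV) (discretize n R))"

text \<open>Justifies \<open>Abs_pmf\<close>: the image measure is concentrated on the countable set
  of extensional functions, hence discrete.\<close>

lemma prob_discrete_law:
  "measure_pmf.prob (discrete_law n R) A = measure (uniform_metric n) (discretize n R -` A \<inter> space (uniform_metric n))"
proof -
  interpret prob_space "uniform_metric n" by (rule prob_space_uniform_metric)
  let ?D = "distr (uniform_metric n) (count_space UNIV) (discretize n R)"
  interpret D: prob_space ?D by (rule prob_space_distr[OF measurable_discretize])
  have "AE x in ?D. measure ?D {x} \<noteq> 0"
  proof (subst D.AE_support_countable)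
    have "AE x in ?D. x \<in> (pairs n \<rightarrow>\<^sub>E (UNIV :: nat set))"
      by (subst AE_distr_iff[OF measurable_discretize]) (auto simp: discretize_def)
    then show "\<exists>S. countable S \<and> (AE x in ?D. x \<in> S)"
      by (intro exI[of _ "pairs n \<rightarrow>\<^sub>E UNIV"]) (auto intro: countable_PiE)
  qed simp
  then have "measure_pmf (discrete_law n R) = ?D"
    unfolding discrete_law_def by (intro Abs_pmf_inverse) (simp add: D.prob_space_axioms)
  then show ?thesis by (simp add: measure_distr[OF measurable_discretize])
qed

lemma sets_vimage_discretize: "discretize n R -` A \<inter> space (lebesgue_pairs n) \<in> sets (lebesgue_pairs n)"
  using measurable_sets[OF measurable_discretize, of A n R] by (simp add: space_uniform_metric sets_uniform_metric)

lemma pmf_discrete_law: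
  "pmf (discrete_law n R) x = measure (lebesgue_pairs n) (metric_polytope n \<inter> discretize n R -` {x}) /
     measure (lebesgue_pairs n) (metric_polytope n)"
proof -
  have "metric_polytope n \<inter> discretize n R -` {x} = metric_polytope n \<inter> (discretize n R -` {x} \<inter> space (lebesgue_pairs n))"
    using metric_polytope_subset_space[of n] by auto
  then show ?thesis
    using measure_uniform_metric[OF sets_vimage_discretize, of n R "{x}"]
    by (simp add: measure_pmf_single[symmetric] prob_discrete_law space_uniform_metric)
qed

lemma set_discrete_lawD:
  assumes "x \<in> set_pmf (discrete_law n R)"
  obtains d where "d \<in> metric_polytope n" "x = discretize n R d"
proof -
  have "pmf (discrete_law n R) x \<noteq> 0" using assms by (simp add: set_pmf_iff)
  then have "metric_polytope n \<inter> discretize n R -` {x} \<noteq> {}"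
    by (auto simp: pmf_discrete_law)
  then show ?thesis using that by blast
qed

lemma exchangeable_discrete_law:
  assumes R: "R \<ge> 1"
  shows "exchangeable_metric n R (discrete_law n R)"
proof
  show "1 \<le> R" by fact
next
  show "set_pmf (discrete_law n R) \<subseteq> pairs n \<rightarrow>\<^sub>E {1..2 * R}"
  proof
    fix x assume "x \<in> set_pmf (discrete_law n R)"
    then obtain d where d: "d \<in> metric_polytope n" "x = discretize n R d" by (rule set_discrete_lawD)
    have "nat \<lceil>R * d e\<rceil> \<in> {1..2 * R}" if "e \<in> pairs n" for e
    proof -
      have "0 < d e" "d e \<le> 2" using d that by (auto simp: metric_polytope_def)
      then have "0 < R * d e" "R * d e \<le> of_int (int (2 * R))" using R by auto
      then have "0 < \<lceil>R * d e\<rceil>" "\<lceil>R * d e\<rceil> \<le> int (2 * R)"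
        by (simp, intro ceiling_le)
      then show ?thesis unfolding atLeastAtMost_iff by linarith
    qed
    then show "x \<in> pairs n \<rightarrow>\<^sub>E {1..2 * R}" by (auto simp: d discretize_def)
  qed
next
  fix x i j k assume x: "x \<in> set_pmf (discrete_law n R)" and ijk: "i \<in> {1..n}" "j \<in> {1..n}" "k \<in> {1..n}"
    "i \<noteq> j" "i \<noteq> k" "j \<noteq> k"
  obtain d where d: "d \<in> metric_polytope n" "x = discretize n R d" using x by (rule set_discrete_lawD)
  have p: "{i, j} \<in> pairs n" "{i, k} \<in> pairs n" "{k, j} \<in> pairs n" using ijk by (auto intro!: pair_in_pairs)
  then have pos: "0 < d {i, k}" "0 < d {k, j}" using d by (auto simp: metric_polytope_def)
  have "d {i, j} \<le> d {i, k} + d {k, j}" using d ijk unfolding metric_polytope_def by blast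
  then have "R * d {i, j} \<le> R * d {i, k} + R * d {k, j}"
    using mult_left_mono[of "d {i, j}" "d {i, k} + d {k, j}" R] by (simp add: distrib_left)
  then have "\<lceil>R * d {i, j}\<rceil> \<le> \<lceil>R * d {i, k}\<rceil> + \<lceil>R * d {k, j}\<rceil>"
    by linarith
  moreover have "0 \<le> \<lceil>R * d {i, k}\<rceil>" "0 \<le> \<lceil>R * d {k, j}\<rceil>"
    using pos by (simp_all add: less_le_trans[of _ 0])
  ultimately have "nat \<lceil>R * d {i, j}\<rceil> \<le> nat \<lceil>R * d {i, k}\<rceil> + nat \<lceil>R * d {k, j}\<rceil>" by linarith
  then show "x {i, j} \<le> x {i, k} + x {k, j}" using p by (simp add: d discretize_def)
next
  fix a b assume ab: "a \<in> {1..n}" "b \<in> {1..n}"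
  show "map_pmf (relabel n a b) (discrete_law n R) = discrete_law n R"
  proof (rule pmf_eqI)
    fix x :: "nat set \<Rightarrow> nat"
    let ?L = "lebesgue_pairs n"
    have "relabel n a b (discretize n R d) = discretize n R (relabel n a b d)" for d
      using ab by (auto simp: relabel_def discretize_def fun_eq_iff transposition_pairs_iff)
    moreover have "relabel n a b d \<in> space ?L" for d by (simp add: space_lebesgue_pairs relabel_def)
    ultimately have "discretize n R -` (relabel n a b -` {x}) \<inter> space ?L =
       relabel n a b -` (discretize n R -` {x} \<inter> space ?L) \<inter> space ?L" by auto
    then show "pmf (map_pmf (relabel n a b) (discrete_law n R)) x = pmf (discrete_law n R) x"
      using measure_uniform_metric_relabel[OF ab sets_vimage_discretize, of R "{x}"]
      by (simp add: pmf_map prob_discrete_law space_uniform_metric measure_pmf_single[symmetric])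
  qed
next
  fix x
  \<comment> \<open>The metrics that round to \<open>x\<close> lie in this cell of side
    \<open>1 / R\<close>; normalising by a volume of at least 1 does not enlarge the bound.\<close>
  let ?L = "lebesgue_pairs n" and ?B = "Pi\<^sub>E (pairs n) (\<lambda>e. {(real (x e) - 1) / R..x e / R})"
  interpret product_sigma_finite "\<lambda>_ :: nat set. lborel :: real measure" by standard
  have B: "?B \<in> sets ?L" unfolding lebesgue_pairs_def by (intro sets_PiM_I_finite) auto
  have "emeasure ?L ?B = (\<Prod>e\<in>pairs n. ennreal (1 / R))"
    unfolding lebesgue_pairs_def using R
    by (subst emeasure_PiM) (auto intro!: prod.cong simp: divide_right_mono diff_divide_distrib)
  then have eB: "emeasure ?L ?B = ennreal (1 / real R ^ card (pairs n))"
    by (simp add: ennreal_power power_divide)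
  have "metric_polytope n \<inter> discretize n R -` {x} \<subseteq> ?B"
  proof
    fix d assume "d \<in> metric_polytope n \<inter> discretize n R -` {x}"
    then have d: "d \<in> metric_polytope n" "x = discretize n R d" by auto
    have "(real (x e) - 1) / R \<le> d e \<and> d e \<le> x e / R" if "e \<in> pairs n" for e
    proof -
      have "0 < d e" using d that by (auto simp: metric_polytope_def)
      then have "real (x e) = of_int \<lceil>R * d e\<rceil>" using that R by (simp add: d discretize_def)
      then have "real (x e) - 1 \<le> R * d e" "R * d e \<le> real (x e)"
        by linarith+
      then have "R * d e \<ge> real (x e) - 1" "d e * R \<le> real (x e)" by (simp_all add: mult.commute)
      then show ?thesis using R by (simp add: pos_divide_le_eq pos_le_divide_eq mult.commute)
    qed
    then show "d \<in> ?B" using d by (auto simp: metric_polytope_def PiE_def)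
  qed
  from emeasure_mono[OF this B]
  have "emeasure ?L (metric_polytope n \<inter> discretize n R -` {x}) \<le> ennreal (1 / real R ^ card (pairs n))"
    by (simp only: eB)
  then have "measure ?L (metric_polytope n \<inter> discretize n R -` {x}) \<le> 1 / real R ^ card (pairs n)"
    unfolding emeasure_metric_polytope_subset by simp
  moreover have "measure ?L (metric_polytope n \<inter> discretize n R -` {x}) / measure ?L (metric_polytope n)
     \<le> measure ?L (metric_polytope n \<inter> discretize n R -` {x}) / 1"
    using measure_metric_polytope_ge_1[of n] by (intro divide_left_mono) auto
  ultimately show "pmf (discrete_law n R) x \<le> 1 / real R ^ card (pairs n)"
    by (simp add: pmf_discrete_law)
qed

section \<open>Short distances are unlikely\<close>

text \<open>Log-concavity makes the ratios of consecutive terms nonincreasing, so a first ratio of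
  at most 1/2 persists. Monotonicity covers the case where a term vanishes.\<close>

lemma log_concave_halving:
  fixes a :: "nat \<Rightarrow> real"
  assumes nonneg: "\<And>k. 0 \<le> a k" and decr: "\<And>k. a (Suc k) \<le> a k"
    and log_concave: "\<And>k. a k * a (Suc (Suc k)) \<le> (a (Suc k))\<^sup>2" and start: "2 * a 1 \<le> a 0"
  shows "2 ^ k * a k \<le> a 0"
proof -
  have half: "2 * a (Suc k) \<le> a k" for k
  proof (induction k)
    case (Suc k)
    show ?case
    proof (cases "a k = 0")
      case True
      then have "a (Suc k) = 0" "a (Suc (Suc k)) = 0"
        using nonneg[of "Suc k"] nonneg[of "Suc (Suc k)"] decr[of k] decr[of "Suc k"] by linarith+
      then show ?thesis by simp
    next
      case False
      then have pos: "a k > 0" using nonneg[of k] by simp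
      have "a k * (2 * a (Suc (Suc k))) \<le> a (Suc k) * (2 * a (Suc k))"
        using log_concave[of k] by (simp add: power2_eq_square)
      also have "\<dots> \<le> a (Suc k) * a k" using Suc nonneg by (intro mult_left_mono)
      finally show ?thesis using pos by (simp add: mult.commute[of "a (Suc k)"])
    qed
  qed (use start in simp)
  show ?thesis
  proof (induction k)
    case (Suc k)
    have "2 ^ Suc k * a (Suc k) = 2 ^ k * (2 * a (Suc k))" by simp
    also have "\<dots> \<le> 2 ^ k * a k" using half by (intro mult_left_mono) auto
    finally show ?case using Suc by linarith
  qed simp
qed

text \<open>The grid scale is \<open>R = n\<close>. Rounding up moves a distance by less than
  \<open>1 / n\<close>, which is below \<open>\<eta>\<close>; hence \<open>1 - \<eta>\<close> for
  the rounded metric becomes \<open>1 - 2 * \<eta>\<close>.\<close>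

lemma entry_cdf_short:
  fixes \<beta> \<eta> :: real
  assumes M: "1 \<le> M" "M + 3 \<le> n" and \<beta>: "0 < \<beta>" "\<beta> \<le> 1 / 4" and \<eta>: "0 < \<eta>" "\<eta> < 1" "\<eta> * n > 1"
  shows "\<eta> * measure (uniform_metric n) {d \<in> space (uniform_metric n). d {1, 2} \<le> 1 - 2 * \<eta>} \<le>
    6 * real M / (real n - 1) * ln (2 * real n) + (3 / n + 7 * \<beta> + 6 * \<beta> * ln (2 * real n / \<beta>)) + 8 * ln (2 * real n) / (M * \<beta> ^ 3)"
proof -
  interpret exchangeable_metric n n "discrete_law n n"
    using M by (intro exchangeable_discrete_law) auto
  interpret U: prob_space "uniform_metric n" by (rule prob_space_uniform_metric)
  have e: "{1, 2} \<in> pairs n" using M by (intro pair_in_pairs) auto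
  have "real (nat \<lceil>real n * t\<rceil>) < (1 - \<eta>) * n" if "t \<le> 1 - 2 * \<eta>" for t
  proof -
    have "real n * t \<le> real n * (1 - 2 * \<eta>)" using that by (intro mult_left_mono) auto
    then have "real n * t + 1 < (1 - \<eta>) * n" using \<eta> by (simp add: algebra_simps)
    moreover have "0 < (1 - \<eta>) * n" using \<eta> M by (intro mult_pos_pos) auto
    \<comment> \<open>The event ranges over all arrays, not only metrics, so \<open>t\<close> may be
      negative; \<open>nat\<close> then returns 0.\<close>
    moreover have "real (nat \<lceil>real n * t\<rceil>) < real n * t + 1 \<or> real (nat \<lceil>real n * t\<rceil>) = 0" by linarith
    ultimately show ?thesis by linarith
  qed
  note ceil = this
  have "measure (uniform_metric n) {d \<in> space (uniform_metric n). d {1, 2} \<le> 1 - 2 * \<eta>} \<le>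
     measure (uniform_metric n) (discretize n n -` {x. x {1, 2} < (1 - \<eta>) * n} \<inter> space (uniform_metric n))"
  proof (rule U.finite_measure_mono)
    show "discretize n n -` {x. x {1, 2} < (1 - \<eta>) * n} \<inter> space (uniform_metric n) \<in> U.events"
      unfolding sets_uniform_metric space_uniform_metric by (rule sets_vimage_discretize)
  qed (use e ceil in \<open>auto simp: discretize_def\<close>)
  also have "\<dots> = measure_pmf.prob (discrete_law n n) {x. x {1, 2} < (1 - \<eta>) * n}"
    by (simp add: prob_discrete_law)
  finally have "\<eta> * measure (uniform_metric n) {d \<in> space (uniform_metric n). d {1, 2} \<le> 1 - 2 * \<eta>} \<le>
      \<eta> * measure_pmf.prob (discrete_law n n) {x. x {1, 2} < (1 - \<eta>) * n}"
    using \<eta> by (intro mult_left_mono) auto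
  also note short_edge_prob[OF M \<beta> less_imp_le less_imp_le, OF \<eta>(1,2)]
  finally show ?thesis by (simp only: of_nat_mult of_nat_numeral)
qed

lemma entry_cdf_lower:
  fixes \<gamma> :: real
  assumes n: "n \<ge> 3" and \<gamma>: "0 < \<gamma>" "\<gamma> \<le> 1 / 2" "\<gamma> * n \<ge> 1"
  shows "measure (uniform_metric n) {d \<in> space (uniform_metric n). d {1, 2} \<le> 1 + 2 * \<gamma>} \<ge> \<gamma>\<^sup>2 / 8"
proof -
  interpret exchangeable_metric n n "discrete_law n n"
    using n by (intro exchangeable_discrete_law) auto
  interpret U: prob_space "uniform_metric n" by (rule prob_space_uniform_metric)
  have e: "{1, 2} \<in> pairs n" using n by (intro pair_in_pairs) auto
  \<comment> \<open>Since \<open>\<gamma> * n \<ge> 1\<close>, rounding up keeps \<open>k\<close>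
    below \<open>(1 + 2 * \<gamma>) * n\<close>; \<open>\<gamma> \<le> 1 / 2\<close> and
    \<open>n \<ge> 3\<close> keep it below \<open>2 * n\<close>.\<close>
  define k where "k = nat \<lceil>(1 + \<gamma>) * n\<rceil>"
  have "0 \<le> (1 + \<gamma>) * n" using \<gamma> by simp
  then have k: "(1 + \<gamma>) * n \<le> k" "k < (1 + \<gamma>) * n + 1" unfolding k_def by linarith+
  have "(1 + \<gamma>) * n + 1 \<le> (1 + 1 / 2) * n + 1" using \<gamma> by (intro add_right_mono mult_right_mono) auto
  also have "\<dots> < 2 * n" using n by simp
  finally have k2: "k < 2 * n" using k by linarith
  have "t \<le> 1 + 2 * \<gamma>" if "nat \<lceil>real n * t\<rceil> \<le> k" for t
  proof -
    have "real n * t \<le> k" using that by linarith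
    then have "real n * t \<le> real n * (1 + 2 * \<gamma>)" using k \<gamma> by (simp add: algebra_simps)
    then show ?thesis using n by simp
  qed
  then have "measure (uniform_metric n) (discretize n n -` {x. x {1, 2} \<le> k} \<inter> space (uniform_metric n)) \<le>
      measure (uniform_metric n) {d \<in> space (uniform_metric n). d {1, 2} \<le> 1 + 2 * \<gamma>}"
    using e entry_le_sets[OF e]
    by (intro U.finite_measure_mono) (auto simp: discretize_def sets_uniform_metric space_uniform_metric)
  moreover have "measure_pmf.prob (discrete_law n n) {x. x {1, 2} \<le> k} \<ge> \<gamma>\<^sup>2 / 8"
    using n \<gamma> k k2 by (intro edge_lower_mass) auto
  ultimately show ?thesis by (simp add: prob_discrete_law)
qed

lemma entry_cdf_tail:
  fixes \<gamma> :: real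
  assumes e: "e \<in> pairs n" and \<gamma>: "0 < \<gamma>"
  defines "F \<equiv> \<lambda>t. measure (uniform_metric n) {d \<in> space (uniform_metric n). d e \<le> t}"
  assumes double: "2 * F (1 - 2 * \<gamma>) \<le> F (1 + 2 * \<gamma>)"
  shows "F (1 + 2 * \<gamma> - 4 * \<gamma> * k) \<le> (1 / 2) ^ k"
proof -
  interpret U: prob_space "uniform_metric n" by (rule prob_space_uniform_metric)
  have mono: "F s \<le> F t" if "s \<le> t" for s t
    unfolding F_def using that entry_le_sets[OF e]
    by (intro U.finite_measure_mono) (auto simp: sets_uniform_metric space_uniform_metric)
  define a where "a k = F (1 + 2 * \<gamma> - 4 * \<gamma> * real k)" for k
  have "2 ^ k * a k \<le> a 0"
  proof (rule log_concave_halving)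
    show "0 \<le> a k" for k by (simp add: a_def F_def)
    show "a (Suc k) \<le> a k" for k unfolding a_def using \<gamma> by (intro mono) (simp add: algebra_simps)
    show "a k * a (Suc (Suc k)) \<le> (a (Suc k))\<^sup>2" for k
    proof -
      have "((1 + 2 * \<gamma> - 4 * \<gamma> * real k) + (1 + 2 * \<gamma> - 4 * \<gamma> * real (Suc (Suc k)))) / 2 =
        1 + 2 * \<gamma> - 4 * \<gamma> * real (Suc k)" by (simp add: field_simps)
      then show ?thesis
        using entry_cdf_log_concave[OF e, of "1 + 2 * \<gamma> - 4 * \<gamma> * real k" "1 + 2 * \<gamma> - 4 * \<gamma> * real (Suc (Suc k))"]
        unfolding a_def F_def by metis
    qed
    show "2 * a 1 \<le> a 0" using double by (simp add: a_def algebra_simps)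
  qed
  moreover have "a 0 \<le> 1" by (simp add: a_def F_def)
  ultimately have "2 ^ k * a k \<le> 1" by linarith
  then show ?thesis by (simp add: a_def power_one_over field_simps)
qed

section \<open>Union bound and choice of exponents\<close>

lemma min_entry_union_bound:
  assumes n: "n \<ge> 2"
  shows "measure (uniform_metric n) {d \<in> space (uniform_metric n). Min (d ` pairs n) \<le> t}
    \<le> real n ^ 2 * measure (uniform_metric n) {d \<in> space (uniform_metric n). d {1, 2} \<le> t}"
proof -
  interpret U: prob_space "uniform_metric n" by (rule prob_space_uniform_metric)
  have "measure (uniform_metric n) {d \<in> space (uniform_metric n). Min (d ` pairs n) \<le> t} \<le>
      measure (uniform_metric n) (\<Union>e\<in>pairs n. {d \<in> space (uniform_metric n). d e \<le> t})"
    using entry_le_sets[of _ n t] pairs_nonempty[OF n]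
    by (intro U.finite_measure_mono sets.finite_UN)
       (auto simp: sets_uniform_metric space_uniform_metric Min_le_iff)
  also have "\<dots> \<le> (\<Sum>e\<in>pairs n. measure (uniform_metric n) {d \<in> space (uniform_metric n). d e \<le> t})"
    using entry_le_sets[of _ n t]
    by (intro U.finite_measure_subadditive_finite) (auto simp: sets_uniform_metric space_uniform_metric)
  also have "\<dots> = card (pairs n) * measure (uniform_metric n) {d \<in> space (uniform_metric n). d {1, 2} \<le> t}"
    by (simp add: entry_cdf_eq)
  also have "\<dots> \<le> real n ^ 2 * measure (uniform_metric n) {d \<in> space (uniform_metric n). d {1, 2} \<le> t}"
  proof (intro mult_right_mono)
    have "pairs n \<subseteq> (\<lambda>(i, j). {i, j}) ` ({1..n} \<times> {1..n})"
      by (auto simp: pairs_def card_2_iff image_iff)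
    then have "card (pairs n) \<le> card ({1..n} \<times> {1..n})" by (intro surj_card_le) auto
    then have "real (card (pairs n)) \<le> real (n * n)" by (simp only: of_nat_le_iff card_cartesian_product card_atLeastAtMost) simp
    then show "real (card (pairs n)) \<le> real n ^ 2" by (simp add: power2_eq_square)
  qed simp
  finally show ?thesis .
qed

text \<open>With \<open>M\<close> about \<open>sqrt n\<close> and
  \<open>\<beta> = n powr (-1/12)\<close>, the error terms have orders \<open>n powr (-1/2)\<close>,
  \<open>n powr (-1/12)\<close> and \<open>n powr (-1/4)\<close> up to logarithms, besides
  \<open>3 / n\<close>. All are below \<open>\<eta> * \<gamma>\<^sup>2 / 16\<close>, of order
  \<open>n powr (-7/200)\<close>, which gives the doubling. The tail starts at distance of order
  \<open>\<gamma> = n powr (-1/200)\<close> from 1 and must reach the much larger distance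
  \<open>n powr (-1/400)\<close>; the ratio of the two is the number of halvings, up to the factor
  4.\<close>

lemma eventually_min_entry_bound:
  "\<forall>\<^sub>F n in sequentially. measure (uniform_metric n)
     {d \<in> space (uniform_metric n). Min (d ` pairs n) \<le> 1 - real n powr (- 1 / 400)} \<le> real n powr (- 1 / 400)"
proof -
  \<comment> \<open>The constant 16 replaces 8 because \<open>M\<close> is a floor and only
    \<open>sqrt n \<le> 2 * M\<close> is available.\<close>
  let ?err = "\<lambda>x :: real. 6 * sqrt x / (x - 1) * ln (2 * x) +
    (3 / x + 7 * x powr (-1/12) + 6 * x powr (-1/12) * ln (2 * x / x powr (-1/12))) + 16 * ln (2 * x) / (sqrt x * x powr (-1/4))"
  have "\<forall>\<^sub>F n :: nat in sequentially. ?err (real n) \<le> real n powr (-1/40) * ((real n powr (-1/200))\<^sup>2 / 16)"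
    by real_asymp
  moreover have "\<forall>\<^sub>F n :: nat in sequentially. real n powr (-1/12) \<le> 1 / 4" by real_asymp
  moreover have "\<forall>\<^sub>F n :: nat in sequentially. real n powr (-1/200) \<le> 1 / 2" by real_asymp
  moreover have "\<forall>\<^sub>F n :: nat in sequentially. real n powr (-1/40) < real n powr (-1/200)" by real_asymp
  moreover have "\<forall>\<^sub>F n :: nat in sequentially. real n powr (-1/40) * real n > 1" by real_asymp
  moreover have "\<forall>\<^sub>F n :: nat in sequentially. sqrt (real n) + 3 \<le> real n" by real_asymp
  moreover have "\<forall>\<^sub>F n :: nat in sequentially. (real n)\<^sup>2 * (2 * 2 powr (- (real n powr (1/400)) / 4)) \<le> real n powr (- 1 / 400)"
    by real_asymp
  moreover have "\<forall>\<^sub>F n :: nat in sequentially. n \<ge> 4" by (rule eventually_ge_at_top)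
  ultimately show ?thesis
  proof eventually_elim
    case (elim n)
    define \<beta> \<eta> \<gamma> where "\<beta> = real n powr (-1/12)" and "\<eta> = real n powr (-1/40)" and "\<gamma> = real n powr (-1/200)"
    define F where "F t = measure (uniform_metric n) {d \<in> space (uniform_metric n). d {1, 2} \<le> t}" for t
    have e: "{1, 2} \<in> pairs n" using elim by (intro pair_in_pairs) auto
    interpret U: prob_space "uniform_metric n" by (rule prob_space_uniform_metric)
    have mono: "F s \<le> F t" if "s \<le> t" for s t
      unfolding F_def using that entry_le_sets[OF e]
      by (intro U.finite_measure_mono) (auto simp: sets_uniform_metric space_uniform_metric)
    have pos: "\<beta> > 0" "\<eta> > 0" "\<gamma> > 0" using elim by (auto simp: \<beta>_def \<eta>_def \<gamma>_def)
    have small: "\<beta> \<le> 1 / 4" "\<eta> < 1" "\<eta> * n > 1" "\<eta> < \<gamma>" "\<gamma> \<le> 1 / 2"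
      unfolding \<beta>_def \<eta>_def \<gamma>_def using elim by linarith+
    have \<beta>3: "\<beta> ^ 3 = real n powr (-1/4)"
      using elim by (simp add: \<beta>_def powr_power)
    define M where "M = nat \<lfloor>sqrt n\<rfloor>"
    have sq: "sqrt n \<ge> 2" using elim by (intro real_le_rsqrt) auto
    then have M: "real M \<le> sqrt n" "sqrt n \<le> 2 * real M" "1 \<le> M" unfolding M_def by linarith+
    have "real (M + 3) \<le> real n" using M elim by simp
    then have M3: "M + 3 \<le> n" by linarith
    have lnn: "ln (2 * real n) \<ge> 0" using elim by simp
    have "\<eta> * F (1 - 2 * \<eta>) \<le> 6 * real M / (real n - 1) * ln (2 * real n) +
        (3 / n + 7 * \<beta> + 6 * \<beta> * ln (2 * real n / \<beta>)) + 8 * ln (2 * real n) / (M * \<beta> ^ 3)"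
      unfolding F_def by (rule entry_cdf_short[OF M(3) M3 pos(1) small(1) pos(2) small(2,3)])
    also have "\<dots> \<le> ?err (real n)"
    proof -
      have "6 * real M / (real n - 1) * ln (2 * real n) \<le> 6 * sqrt n / (real n - 1) * ln (2 * real n)"
        using M elim lnn by (intro mult_right_mono divide_right_mono) auto
      moreover have "8 * ln (2 * real n) / (M * \<beta> ^ 3) = 16 * ln (2 * real n) / ((2 * M) * \<beta> ^ 3)" by simp
      moreover have "\<dots> \<le> 16 * ln (2 * real n) / (sqrt n * \<beta> ^ 3)"
        using M elim lnn pos by (intro divide_left_mono mult_right_mono) auto
      ultimately show ?thesis unfolding \<beta>3 unfolding \<beta>_def by simp
    qed
    also have "\<dots> \<le> \<eta> * (\<gamma>\<^sup>2 / 16)" using elim(1) by (simp only: \<eta>_def \<gamma>_def)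
    finally have "F (1 - 2 * \<eta>) \<le> \<gamma>\<^sup>2 / 16" using pos by simp
    moreover have "F (1 - 2 * \<gamma>) \<le> F (1 - 2 * \<eta>)" using small by (intro mono) simp
    moreover have "F (1 + 2 * \<gamma>) \<ge> \<gamma>\<^sup>2 / 8"
    proof -
      have "\<eta> * n \<le> \<gamma> * n" using small by (intro mult_right_mono) auto
      then have "1 \<le> \<gamma> * n" using small(3) by linarith
      then show ?thesis unfolding F_def
        using elim(8) pos small by (intro entry_cdf_lower) auto
    qed
    ultimately have double: "2 * F (1 - 2 * \<gamma>) \<le> F (1 + 2 * \<gamma>)" by linarith
    \<comment> \<open>\<open>L\<close> is the target distance divided by \<open>\<gamma>\<close>, so
      \<open>k\<close> steps of length \<open>4 * \<gamma>\<close> stay within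
      \<open>n powr (-1/400)\<close>.\<close>
    define L where "L = real n powr (1/400)"
    have L: "L > 0" using elim by (simp add: L_def)
    define k where "k = nat \<lfloor>L / 4\<rfloor>"
    have k: "real k \<le> L / 4" "L / 4 - 1 \<le> real k" using L unfolding k_def by linarith+
    have "4 * \<gamma> * k \<le> 4 * \<gamma> * (L / 4)" using k pos by (intro mult_left_mono) auto
    also have "\<dots> = real n powr (- 1 / 400)"
      using elim by (simp add: \<gamma>_def L_def powr_add[symmetric])
    finally have "F (1 - real n powr (- 1 / 400)) \<le> F (1 + 2 * \<gamma> - 4 * \<gamma> * k)"
      using pos by (intro mono) simp
    also have "\<dots> \<le> (1 / 2) ^ k"
      using double unfolding F_def by (intro entry_cdf_tail e pos)
    also have "\<dots> = 2 powr (- real k)" by (simp add: powr_minus powr_realpow power_one_over inverse_eq_divide)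
    \<comment> \<open>The floor in \<open>k\<close> loses at most one halving, which accounts for
      the factor 2.\<close>
    also have "\<dots> \<le> 2 powr (1 + - L / 4)" using k by (intro powr_mono) auto
    also have "\<dots> = 2 * 2 powr (- L / 4)" by (subst powr_add) simp
    finally have "F (1 - real n powr (- 1 / 400)) \<le> 2 * 2 powr (- L / 4)" .
    then have "(real n)\<^sup>2 * F (1 - real n powr (- 1 / 400)) \<le> (real n)\<^sup>2 * (2 * 2 powr (- L / 4))"
      by (intro mult_left_mono) auto
    also have "\<dots> \<le> real n powr (- 1 / 400)" using elim(7) by (simp only: L_def)
    finally show ?case
      using min_entry_union_bound[of n "1 - real n powr (- 1 / 400)"] elim by (simp add: F_def)
  qed
qed

theorem theorem1p3:
  shows "\<exists>C c :: real. C > 0 \<and> c > 0 \<and>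
    (\<forall>n::nat. n \<ge> 2 \<longrightarrow>
      \<P>(d in uniform_metric n. Min (d ` pairs n) \<le> 1 - real n powr (- c)) \<le> C * real n powr (- c))"
proof -
  obtain N where N: "\<And>n. n \<ge> N \<Longrightarrow> measure (uniform_metric n)
     {d \<in> space (uniform_metric n). Min (d ` pairs n) \<le> 1 - real n powr (- 1 / 400)} \<le> real n powr (- 1 / 400)"
    using eventually_min_entry_bound unfolding eventually_sequentially by blast
  \<comment> \<open>For \<open>n < N\<close> this makes the right-hand side at least 1, so the bound
    is trivial there.\<close>
  define C where "C = max 1 (real N powr (1 / 400))"
  have "\<P>(d in uniform_metric n. Min (d ` pairs n) \<le> 1 - real n powr (- (1 / 400))) \<le> C * real n powr (- (1 / 400))"
    if "n \<ge> 2" for n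
  proof (cases "n \<ge> N")
    case True
    have "real n powr (- (1 / 400)) \<le> C * real n powr (- (1 / 400))"
      using mult_right_mono[of 1 C "real n powr (- (1 / 400))"] by (simp add: C_def)
    with N[OF True] show ?thesis by simp
  next
    case False
    interpret U: prob_space "uniform_metric n" by (rule prob_space_uniform_metric)
    have "1 = real n powr (1 / 400) * real n powr (- (1 / 400))"
      using that by (simp add: powr_add[symmetric])
    also have "\<dots> \<le> C * real n powr (- (1 / 400))"
      using False by (intro mult_right_mono) (auto simp: C_def le_max_iff_disj intro!: disjI2 powr_mono2)
    finally show ?thesis using U.prob_le_1 by (meson order_trans)
  qed
  then show ?thesis by (intro exI[of _ C] exI[of _ "1 / 400"]) (auto simp: C_def)
qed

end
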